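(* Let $\epsilon\in(0,1)$ and $0<\zeta<1$. Let $\mathcal F:(M_1,\tau)\to L^1(\mathcal X,\Sigma_{|\mathcal Y|})$ be continuous and satisfy: (i) for every $\nu\in M_1$ and every $x$ in the support of $\nu_x$, $\tfrac12\sum_y|\nu_{y|x}(y|x)-(\mathcal F\nu)(y|x)|\le\tfrac12\sum_y|p_{Y|X}(y|x)-(\mathcal F\nu)(y|x)|$; (ii) for every $\nu\in M_1$, $\mathbb E_{\nu}\big[\tfrac12\sum_y|\nu_{y|x}(y|x)-(\mathcal F\nu)(y|x)|\big]\le\zeta$. Let $L_m$ be the empirical measure of $m$ i.i.d. samples from $\mathbb P_{XY}$, $\mathbb P^m$ the induced law, and $\mathbb P_f=\mathcal F L_m$. Then $$\limsup_{m\to\infty}\frac1m\log\mathbb P^m\big(\bar\delta(\mathbb P_f)\ge\epsilon\big)\le 4\zeta-2\epsilon^2.$$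
   Context: $\mathcal X$ Polish, $\mathcal Y$ finite with discrete topology; $\mathbb P_{XY}$ is the true distribution with density $p(x,y)$, marginal $\mathbb P_X$ of full support, conditional $p_{Y|X}$. $M_1$ is the set of Borel probability measures on $\mathcal X\times\mathcal Y$; for $\nu\in M_1$, $\nu_x$ is its $\mathcal X$-marginal and $\nu_{y|x}$ its conditional (disintegration) on $\mathcal Y$. The $\tau$-topology on $M_1$ is generated by the sets $\{\nu:|\int f\,d\nu-r|<c\}$ for all bounded Borel measurable $f$, $r\in\mathbb R$, $c>0$. $\Sigma_{|\mathcal Y|}$ is the probability simplex on $\mathcal Y$; $L^1(\mathcal X,\Sigma_{|\mathcal Y|})$ is the set of measurable maps $\mathcal X\to\Sigma_{|\mathcal Y|}$ with metric $d(f,g)=\tfrac12\int\sum_y|f(y|x)-g(y|x)|\,d\mathbb P_X$. For a conditional $q(y|x)$, $\bar\delta(q):=\mathbb E_{\mathbb P_X}\big[\tfrac12\sum_y|p_{Y|X}(y|x)-q(y|x)|\big]$. *)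

theory Defs
  imports "HOL-Probability.Probability"
begin

definition XY :: "('x::topological_space \<times> 'y) measure" where
  "XY = (borel :: 'x measure) \<Otimes>\<^sub>M (count_space UNIV :: 'y measure)"

definition M1 :: "('x::topological_space \<times> 'y) measure set" where
  "M1 = {\<nu>. prob_space \<nu> \<and> sets \<nu> = sets XY}"

definition marg :: "('x::topological_space \<times> 'y) measure \<Rightarrow> 'x measure" where
  "marg \<nu> = distr \<nu> borel fst"

definition msupport :: "'x::topological_space measure \<Rightarrow> 'x set" where
  "msupport \<mu> = {x. \<forall>U. open U \<and> x \<in> U \<longrightarrow> emeasure \<mu> U > 0}"

definition in_simplex :: "('y::finite \<Rightarrow> real) \<Rightarrow> bool" where
  "in_simplex a \<longleftrightarrow> (\<forall>y. 0 \<le> a y) \<and> (\<Sum>y\<in>UNIV. a y) = 1"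

text \<open>Measurable maps X -> simplex (elements of L^1(X, Sigma_|Y|), as functions).\<close>
definition Lsimp :: "('x::topological_space \<Rightarrow> 'y::finite \<Rightarrow> real) set" where
  "Lsimp = {f. (\<forall>y. (\<lambda>x. f x y) \<in> borel_measurable borel) \<and> (\<forall>x. in_simplex (f x))}"

definition tv :: "('y::finite \<Rightarrow> real) \<Rightarrow> ('y \<Rightarrow> real) \<Rightarrow> real" where
  "tv a b = (1/2) * (\<Sum>y\<in>UNIV. \<bar>a y - b y\<bar>)"

definition dL1 :: "'x::topological_space measure \<Rightarrow> ('x \<Rightarrow> 'y::finite \<Rightarrow> real) \<Rightarrow> ('x \<Rightarrow> 'y \<Rightarrow> real) \<Rightarrow> real" where
  "dL1 PX f g = (\<integral>x. tv (f x) (g x) \<partial>PX)"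

definition is_cond :: "('x::topological_space \<times> 'y::finite) measure \<Rightarrow> ('x \<Rightarrow> 'y \<Rightarrow> real) \<Rightarrow> bool" where
  "is_cond \<nu> q \<longleftrightarrow> q \<in> Lsimp \<and>
     (\<forall>A\<in>sets borel. \<forall>y. measure \<nu> (A \<times> {y}) = (\<integral>x. indicator A x * q x y \<partial>(marg \<nu>)))"

definition delta_bar :: "'x::topological_space measure \<Rightarrow> ('x \<Rightarrow> 'y::finite \<Rightarrow> real) \<Rightarrow> ('x \<Rightarrow> 'y \<Rightarrow> real) \<Rightarrow> real" where
  "delta_bar PX p q = (\<integral>x. tv (p x) (q x) \<partial>PX)"

definition tau_subbasis :: "('x::topological_space \<times> 'y) measure set set" where
  "tau_subbasis = {{\<nu>\<in>M1. \<bar>(\<integral>z. f z \<partial>\<nu>) - r\<bar> < c} | (f :: 'x \<times> 'y \<Rightarrow> real) (r::real) (c::real).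
      f \<in> borel_measurable XY \<and> bounded (range f) \<and> c > 0}"

definition tau_top :: "('x::topological_space \<times> 'y) measure topology" where
  "tau_top = topology_generated_by tau_subbasis"

definition tau_continuous ::
  "'x::topological_space measure \<Rightarrow> (('x \<times> 'y::finite) measure \<Rightarrow> 'x \<Rightarrow> 'y \<Rightarrow> real) \<Rightarrow> bool" where
  "tau_continuous PX F \<longleftrightarrow> (\<forall>\<nu>\<in>M1. F \<nu> \<in> Lsimp) \<and>
     (\<forall>\<nu>\<in>M1. \<forall>e>0. \<exists>U. openin tau_top U \<and> \<nu> \<in> U \<and> (\<forall>\<mu>\<in>U. dL1 PX (F \<mu>) (F \<nu>) < e))"

definition empirical :: "nat \<Rightarrow> (nat \<Rightarrow> 'x::topological_space \<times> 'y) \<Rightarrow> ('x \<times> 'y) measure" where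
  "empirical m w = distr (uniform_count_measure {..<m}) XY w"

text \<open>Outer probability (used since measurability of the event is not asserted).\<close>
definition outer_prob :: "'a measure \<Rightarrow> 'a set \<Rightarrow> real" where
  "outer_prob M S = Inf {measure M A | A. A \<in> sets M \<and> S \<subseteq> A}"

definition elog :: "real \<Rightarrow> ereal" where
  "elog p = (if p \<le> 0 then -\<infinity> else ereal (ln p))"

end

theory Submission
  imports Defs
begin

text \<open>Only the exponential Chebyshev inequality and a compactness argument are needed from large
  deviation theory, and relative entropy never appears. Let \<open>\<nu>\<close> be a measure with
  \<open>delta_bar (F \<nu>) \<ge> \<epsilon>\<close>, let \<open>f = F \<nu>\<close>, and tilt by
  \<open>g (x, y) = - 4 * c x * (1\<^sub>A (x, y) - f\<^sub>x (A\<^sub>x))\<close>, where \<open>A\<^sub>x\<close> is the set of labels on which \<open>pc\<close>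
  exceeds \<open>f\<close> and \<open>0 \<le> c x \<le> 1\<close>. The fitting condition gives \<open>\<integral> g d\<nu> \<ge> - 4 * \<zeta>\<close>, so it suffices to
  choose \<open>c\<close> with \<open>\<integral> exp g dP \<le> exp (- 2 * \<epsilon>\<^sup>2)\<close>. Writing \<open>a x = tv (pc x) (f x)\<close>, this follows by
  integration if the Bernoulli moment generating function at each \<open>x\<close> lies below a decreasing affine
  function of \<open>a x\<close> whose value at \<open>\<epsilon>\<close> is at most \<open>exp (- 2 * \<epsilon>\<^sup>2)\<close>. Pinsker's inequality (Hoeffding's
  choice \<open>c = a\<close>) does not suffice for this, since \<open>exp (- 2 * a\<^sup>2)\<close> is not concave beyond \<open>1/2\<close>;
  the sharp bound, and the constraint \<open>c \<le> 1\<close> together with \<open>f\<^sub>x (A\<^sub>x) \<le> 1 - a x\<close> near \<open>a = 1\<close>, do.\<close>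

section \<open>Affine bounds for tilted Bernoulli moment generating functions\<close>

lemma exp_ge_even_Taylor:
  fixes x :: real
  assumes "even n"
  shows "(\<Sum>k<n. x ^ k / fact k) \<le> exp x"
proof -
  obtain t where "exp x = (\<Sum>k<n. x ^ k / fact k) + exp t / fact n * x ^ n"
    using Maclaurin_exp_le[of x n] by blast
  moreover have "0 \<le> exp t / fact n * x ^ n"
    using assms by (simp add: zero_le_even_power)
  ultimately show ?thesis by linarith
qed

text \<open>Taking reciprocals of the lower bound at \<open>- x\<close> gives an upper bound. The
  two lemmas reduce the numerical estimates of \<open>exp\<close> in this section to rational
  arithmetic.\<close>

lemma exp_le_inverse_even_Taylor:
  fixes x :: real
  assumes "even n" "0 < b" "1 / b \<le> (\<Sum>k<n. (- x) ^ k / fact k)"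
  shows "exp x \<le> b"
proof -
  have "1 / b \<le> exp (- x)"
    using assms(3) exp_ge_even_Taylor[OF assms(1), of "- x"] by linarith
  then show ?thesis
    using assms(2) by (simp add: exp_minus field_simps)
qed

text \<open>Factoring out \<open>exp (- s)\<close> leaves the moment generating function of a
  Bernoulli variable with parameter \<open>1 - p\<close> at \<open>s\<close>, to which Hoeffding's
  lemma applies.\<close>

lemma Bernoulli_mgf_le_Hoeffding:
  fixes p s :: real
  assumes "0 \<le> p" "p \<le> 1" "0 \<le> s"
  shows "1 - p + p * exp (- s) \<le> exp (s\<^sup>2 / 8 - s * p)"
proof -
  let ?z = "1 + (1 - p) * (exp s - 1)"
  have "0 \<le> (1 - p) * (exp s - 1)" using assms by simp
  then have z: "?z \<ge> 1" by linarith
  have "- s * (1 - p) + ln ?z \<le> s\<^sup>2 / 8"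
    using Hoeffdings_lemma_aux[of s "1 - p"] assms by simp
  then have "ln ?z \<le> s\<^sup>2 / 8 + s * (1 - p)" by simp
  then have "?z \<le> exp (s\<^sup>2 / 8 + s * (1 - p))"
    using z ln_le_cancel_iff[of ?z "exp (s\<^sup>2 / 8 + s * (1 - p))"] by simp
  then have "exp (- s) * ?z \<le> exp (- s) * exp (s\<^sup>2 / 8 + s * (1 - p))"
    by (intro mult_left_mono) auto
  also have "\<dots> = exp (s\<^sup>2 / 8 - s * p)"
    by (simp flip: exp_add add: algebra_simps)
  finally show ?thesis
    by (simp add: algebra_simps flip: exp_add)
qed

text \<open>For the optimal choice \<open>x = s / (1 - exp (- s))\<close> this is the tangent inequality for the
  logarithm at the point where the dependence on \<open>p\<close> is exactly \<open>exp (- s * p)\<close>.\<close>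
lemma Bernoulli_mgf_le_sharp:
  fixes p s x :: real
  assumes "0 \<le> p" "0 < x" "s \<le> x * (1 - exp (- s))"
  shows "1 - p + p * exp (- s) \<le> exp (x - 1 - s * p) / x"
proof -
  have "s * p \<le> x * (1 - exp (- s)) * p"
    using assms by (intro mult_right_mono) auto
  then have "x * (1 - p + p * exp (- s)) \<le> 1 + (x - 1 - s * p)"
    by (simp add: algebra_simps)
  also have "\<dots> \<le> exp (x - 1 - s * p)" by (rule exp_ge_add_one_self)
  finally show ?thesis using assms by (simp add: field_simps)
qed

text \<open>This is the expectation of \<open>exp (- 4 * c * (1\<^sub>A - \<alpha>))\<close> for an
  event of probability \<open>p\<close>. The factor 4 makes \<open>c = a\<close> optimal in
  Hoeffding's bound when \<open>p = \<alpha> + a\<close>.\<close>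

definition tilted_mgf :: "real \<Rightarrow> real \<Rightarrow> real \<Rightarrow> real" where
  "tilted_mgf c \<alpha> p = exp (4 * c * \<alpha>) * (1 - p + p * exp (- (4 * c)))"

lemma tilted_mgf_le_Hoeffding:
  assumes "0 \<le> \<alpha>" "0 \<le> a" "\<alpha> + a \<le> 1"
  shows "tilted_mgf a \<alpha> (\<alpha> + a) \<le> exp (- 2 * a\<^sup>2)"
proof -
  have "tilted_mgf a \<alpha> (\<alpha> + a) \<le> exp (4 * a * \<alpha>) * exp ((4 * a)\<^sup>2 / 8 - 4 * a * (\<alpha> + a))"
    unfolding tilted_mgf_def
    using Bernoulli_mgf_le_Hoeffding[of "\<alpha> + a" "4 * a"] assms by (intro mult_left_mono) auto
  also have "\<dots> = exp (- 2 * a\<^sup>2)"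
    by (simp flip: exp_add add: power2_eq_square algebra_simps)
  finally show ?thesis .
qed

text \<open>Multiplied by \<open>exp (4 * c * \<alpha>)\<close>, the sharp bound no longer depends
  on \<alpha> and is convex in \<open>a\<close>, so on \<open>[u, v]\<close> it lies below a line as
  soon as it does so at both ends.\<close>

lemma tilted_mgf_le_line:
  fixes c x u v l k :: real
  assumes x: "0 < x" "4 * c \<le> x * (1 - exp (- (4 * c)))"
    and u: "exp (x - 1 - 4 * c * u) \<le> x * (l - k * u)"
    and v: "exp (x - 1 - 4 * c * v) \<le> x * (l - k * v)"
    and a: "u \<le> a" "a \<le> v" and \<alpha>: "0 \<le> \<alpha>" "0 \<le> \<alpha> + a"
  shows "tilted_mgf c \<alpha> (\<alpha> + a) \<le> l - k * a"
proof -
  have "tilted_mgf c \<alpha> (\<alpha> + a) \<le> exp (4 * c * \<alpha>) * (exp (x - 1 - 4 * c * (\<alpha> + a)) / x)"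
    unfolding tilted_mgf_def
    using Bernoulli_mgf_le_sharp[OF \<alpha>(2) x] by (intro mult_left_mono) auto
  also have "\<dots> = exp (x - 1 - 4 * c * a) / x"
    by (simp flip: exp_add add: algebra_simps)
  also have "\<dots> \<le> l - k * a"
  proof (cases "u = v")
    case True
    then show ?thesis using u a x by (simp add: field_simps)
  next
    case False
    define t where "t = (a - u) / (v - u)"
    have t: "0 \<le> t" "t \<le> 1" "a = (1 - t) * u + t * v"
      using False a by (auto simp: t_def divide_simps) (simp add: algebra_simps)
    have "exp (x - 1 - 4 * c * a) = exp ((1 - t) *\<^sub>R (x - 1 - 4 * c * u) + t *\<^sub>R (x - 1 - 4 * c * v))"
      by (simp add: t(3) algebra_simps)
    also have "\<dots> \<le> (1 - t) * exp (x - 1 - 4 * c * u) + t * exp (x - 1 - 4 * c * v)"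
      using convex_onD[OF convex_on_exp[of 1, simplified], of t "x - 1 - 4 * c * u" "x - 1 - 4 * c * v"] t
      by auto
    also have "\<dots> \<le> (1 - t) * (x * (l - k * u)) + t * (x * (l - k * v))"
      using t u v by (intro add_mono mult_left_mono) auto
    also have "\<dots> = x * (l - k * a)" by (simp add: t(3) algebra_simps)
    finally show ?thesis using x by (simp add: field_simps)
  qed
  finally show ?thesis .
qed

section \<open>Lines compared with the Gaussian\<close>

lemma gaussian_le_tangent:
  fixes a e :: real
  assumes "0 \<le> e" "e \<le> 1/2" "0 \<le> a" "a \<le> 1/2"
  shows "exp (- 2 * a\<^sup>2) \<le> exp (- 2 * e\<^sup>2) * (1 + 4 * e\<^sup>2) - exp (- 2 * e\<^sup>2) * 4 * e * a"
proof -
  let ?f = "\<lambda>x::real. - exp (- 2 * x\<^sup>2)"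
  let ?f' = "\<lambda>x::real. 4 * x * exp (- 2 * x\<^sup>2)"
  let ?f'' = "\<lambda>x::real. 4 * exp (- 2 * x\<^sup>2) * (1 - 4 * x\<^sup>2)"
  have d1: "(?f has_real_derivative ?f' x) (at x)" for x
    by (auto intro!: derivative_eq_intros simp: power2_eq_square)
  have d2: "(?f' has_real_derivative ?f'' x) (at x)" for x
    by (auto intro!: derivative_eq_intros simp: power2_eq_square algebra_simps)
  \<comment> \<open>On the positive axis the Gaussian is concave exactly up to \<open>1/2\<close>,
    which is why \<open>e\<close> and \<open>a\<close> are confined to
    \<open>[0, 1/2]\<close>.\<close>
  have "?f'' x \<ge> 0" if "x \<in> {0..1/2}" for x
  proof -
    have "x\<^sup>2 \<le> (1/2)\<^sup>2" using that by (intro power_mono) auto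
    then show ?thesis by (simp add: power2_eq_square)
  qed
  then have "?f' e * (a - e) \<le> ?f a - ?f e"
    using f''_imp_f'[of "{0..1/2}" ?f ?f' ?f'' e a] d1 d2 assms by auto
  then show ?thesis by (simp add: algebra_simps power2_eq_square)
qed

text \<open>The line is chosen so that its ratio to the Gaussian is stationary at \<open>r\<close>; the only other
  stationary point is \<open>1 / (4 * r)\<close>.\<close>
lemma line_le_gaussian:
  fixes m r e e0 :: real
  assumes r: "1/2 \<le> r" and m: "0 < m" "m \<le> exp (- 2 * r\<^sup>2)" and e: "e0 \<le> e"
    and start: "m * (1 + 4 * r * (r - e0)) \<le> exp (- 2 * e0\<^sup>2)"
  shows "m * (1 + 4 * r * (r - e)) \<le> exp (- 2 * e\<^sup>2)"
proof -
  let ?b = "1 / (4 * r)"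
  \<comment> \<open>\<open>?\<phi>\<close> is the line divided by the Gaussian. It decreases up to
    \<open>?b\<close>, increases from \<open>?b\<close> to \<open>r\<close> and decreases
    afterwards, so its values at \<open>e0\<close> and \<open>r\<close> control everything to the
    right of \<open>e0\<close>.\<close>
  let ?\<phi> = "\<lambda>x. exp (2 * x\<^sup>2) * (m * (1 + 4 * r * (r - x)))"
  let ?\<phi>' = "\<lambda>x. - 16 * r * m * exp (2 * x\<^sup>2) * ((x - r) * (x - ?b))"
  have eq: "?\<phi> x \<le> 1 \<longleftrightarrow> m * (1 + 4 * r * (r - x)) \<le> exp (- 2 * x\<^sup>2)" for x
    by (simp add: exp_minus field_simps)
  have b: "?b \<le> r"
  proof -
    have "(1/2) * (1/2) \<le> r * r" using r by (intro mult_mono) auto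
    then show ?thesis using r by (simp add: field_simps)
  qed
  have d: "(?\<phi> has_real_derivative ?\<phi>' x) (at x)" for x
    using r by (auto intro!: derivative_eq_intros simp: field_simps power2_eq_square)
  have stat: "?\<phi> r \<le> 1" using m by (subst eq) simp
  have neg: "?\<phi>' x \<le> 0" if "0 \<le> (x - r) * (x - ?b)" for x
    using that r m by (simp add: mult_nonneg_nonneg)
  have pos: "0 \<le> ?\<phi>' x" if "(x - r) * (x - ?b) \<le> 0" for x
    using that r m by (simp add: mult_nonneg_nonpos mult_le_0_iff)
  consider "e \<le> ?b" | "?b \<le> e" "e \<le> r" | "r \<le> e" by linarith
  then have "?\<phi> e \<le> 1"
  proof cases
    case 1
    have "?\<phi> e \<le> ?\<phi> e0"
    proof (rule DERIV_nonpos_imp_nonincreasing[OF e])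
      fix x assume "e0 \<le> x" "x \<le> e"
      then show "\<exists>y. (?\<phi> has_real_derivative y) (at x) \<and> y \<le> 0"
        using d neg[of x] 1 b by (intro exI[of _ "?\<phi>' x"] conjI d neg mult_nonpos_nonpos) auto
    qed
    also have "\<dots> \<le> 1" using start by (subst eq)
    finally show ?thesis .
  next
    case 2
    have "?\<phi> e \<le> ?\<phi> r"
    proof (rule DERIV_nonneg_imp_nondecreasing[OF 2(2)])
      fix x assume "e \<le> x" "x \<le> r"
      then show "\<exists>y. (?\<phi> has_real_derivative y) (at x) \<and> 0 \<le> y"
        using 2 by (intro exI[of _ "?\<phi>' x"] conjI d pos mult_nonpos_nonneg) auto
    qed
    with stat show ?thesis by linarith
  next
    case 3
    have "?\<phi> e \<le> ?\<phi> r"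
    proof (rule DERIV_nonpos_imp_nonincreasing[OF 3])
      fix x assume "r \<le> x" "x \<le> e"
      then show "\<exists>y. (?\<phi> has_real_derivative y) (at x) \<and> y \<le> 0"
        using b by (intro exI[of _ "?\<phi>' x"] conjI d neg mult_nonneg_nonneg) auto
    qed
    with stat show ?thesis by linarith
  qed
  then show ?thesis by (subst (asm) eq)
qed

text \<open>The slope is the one required by \<open>line_le_gaussian\<close>. The value at \<open>1\<close> stays above \<open>exp (-4)\<close>,
  the smallest moment generating function attainable at \<open>a = 1\<close>; this leaves hardly any freedom in
  the choice of the constants.\<close>
definition tilting_line :: "real \<Rightarrow> real" where
  "tilting_line a = 49025/100000 * (1 + 4 * (597/1000) * (597/1000 - a))"

lemma tilting_line_alt: "tilting_line a = tilting_line 0 - 4 * (597/1000) * (49025/100000) * a"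
  by (simp add: tilting_line_def algebra_simps)

text \<open>The constant \<open>49025/100000\<close> is slightly less than
  \<open>exp (- 2 * r\<^sup>2)\<close> at \<open>r = 597/1000\<close>; besides this stationary point
  only the left end \<open>2/5\<close> has to be checked.\<close>

lemma tilting_line_le_gaussian:
  assumes "2/5 \<le> e" shows "tilting_line e \<le> exp (- 2 * e\<^sup>2)"
  unfolding tilting_line_def
proof (rule line_le_gaussian[where ?e0.0 = "2/5"])
  show "49025/100000 \<le> exp (- 2 * (597/1000)\<^sup>2::real)"
    by (rule order_trans[OF _ exp_ge_even_Taylor[of 8]])
       (simp_all add: lessThan_nat_numeral fact_numeral power_divide)
  show "49025 / 100000 * (1 + 4 * (597 / 1000) * (597 / 1000 - 2 / 5)) \<le> exp (- 2 * (2 / 5)\<^sup>2::real)"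
    by (rule order_trans[OF _ exp_ge_even_Taylor[of 8]])
       (simp_all add: lessThan_nat_numeral fact_numeral power_divide)
qed (use assms in auto)


lemma line_le_line_between:
  fixes l k l' k' :: real
  assumes "l' - k' * u \<le> l - k * u" "l' - k' * v \<le> l - k * v" "u \<le> a" "a \<le> v"
  shows "l' - k' * a \<le> l - k * a"
proof (cases "k \<le> k'")
  case True
  then have "(k' - k) * u \<le> (k' - k) * a" using assms by (intro mult_left_mono) auto
  then show ?thesis using assms by (simp add: algebra_simps)
next
  case False
  then have "(k - k') * a \<le> (k - k') * v" using assms by (intro mult_left_mono) auto
  then show ?thesis using assms by (simp add: algebra_simps)
qed

text \<open>The breakpoints and the values of \<open>c\<close> were found numerically. Between breakpoints the sharp bound is
  convex in \<open>a\<close>, so only the endpoints have to be checked; for \<open>a \<ge> 4/5\<close> the worst case is \<open>\<alpha> = 0\<close>.\<close>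
lemma tilted_mgf_le_tilting_line:
  assumes \<alpha>: "0 \<le> \<alpha>" "\<alpha> + a \<le> 1" and a: "63/200 \<le> a" "a \<le> 1"
  shows "tilted_mgf (if a < 81/200 then 153/400 else if a < 3/5 then 99/200 else 1) \<alpha> (\<alpha> + a) \<le> tilting_line a"
proof -
  note num = exp_le_inverse_even_Taylor
  note numsimps = lessThan_nat_numeral fact_numeral power_divide
  let ?k = "4 * (597/1000) * (49025/100000) :: real"
  have e153: "exp (- (4 * (153/400))) \<le> (21655/100000 :: real)"
    by (rule num[of 10]; simp add: numsimps)
  have e198: "exp (- (4 * (99/200))) \<le> (1381/10000 :: real)"
    by (rule num[of 10]; simp add: numsimps)
  have e4: "exp (- (4 * 1)) \<le> (184/10000 :: real)"
    by (rule num[of 12]; simp add: numsimps)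
  \<comment> \<open>The arguments are \<open>x - 1 - 4 * c * a\<close> at the ends of each interval,
    where \<open>x\<close> is \<open>s / (1 - exp (- s))\<close> for \<open>s = 4 * c\<close>,
    rounded up.\<close>
  have ends1: "exp (9421/20000) \<le> (32039/20000 :: real)" "exp (6667/20000) \<le> (34901/25000 :: real)"
    by (rule num[of 6]; simp add: numsimps)+
  have ends2: "exp (1239/2500) \<le> (41053/25000 :: real)" "exp (219/2000) \<le> (1117/1000 :: real)"
    by (rule num[of 6]; simp add: numsimps)+
  have ends3: "exp (27/40) \<le> (98687/50000 :: real)" "exp (- (1/8)) \<le> (9559/10000 :: real)"
    by (rule num[of 6]; simp add: numsimps)+
  consider "a < 81/200" | "81/200 \<le> a" "a < 3/5" | "3/5 \<le> a" "a \<le> 4/5" | "4/5 \<le> a" by linarith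
  then show ?thesis
  proof cases
    case 1
    have "tilted_mgf (153/400) \<alpha> (\<alpha> + a) \<le> tilting_line 0 - ?k * a"
    proof (rule tilted_mgf_le_line[where x = "1953/1000" and u = "63/200" and v = "81/200"])
    qed (use 1 \<alpha> a e153 ends1 in \<open>auto simp: tilting_line_def\<close>)
    then show ?thesis using 1 by (simp add: tilting_line_alt[of a])
  next
    case 2
    have "tilted_mgf (99/200) \<alpha> (\<alpha> + a) \<le> tilting_line 0 - ?k * a"
    proof (rule tilted_mgf_le_line[where x = "22975/10000" and u = "81/200" and v = "3/5"])
    qed (use 2 \<alpha> a e198 ends2 in \<open>auto simp: tilting_line_def\<close>)
    then show ?thesis using 2 by (simp add: tilting_line_alt[of a])
  next
    case 3
    have "tilted_mgf 1 \<alpha> (\<alpha> + a) \<le> tilting_line 0 - ?k * a"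
    proof (rule tilted_mgf_le_line[where x = "4075/1000" and u = "3/5" and v = "4/5"])
    qed (use 3 \<alpha> a e4 ends3 in \<open>auto simp: tilting_line_def\<close>)
    then show ?thesis using 3 by (simp add: tilting_line_alt[of a])
  next
    case 4
    let ?\<kappa> = "1 - exp (-4 :: real)"
    have \<kappa>: "(9816/10000) \<le> ?\<kappa>" using e4 by simp
    \<comment> \<open>\<open>?y\<close> is the moment generating function at
      \<open>\<alpha> = 0\<close>. Because \<open>4 * ?y \<le> ?\<kappa>\<close>, the inequality
      \<open>1 - 4 * \<alpha> \<le> exp (- (4 * \<alpha>))\<close> bounds the value at every other
      \<alpha> by \<open>?y\<close>.\<close>
    let ?y = "1 - a * ?\<kappa>"
    have "4/5 * (9816/10000) \<le> a * ?\<kappa>" using 4 \<kappa> by (intro mult_mono) auto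
    then have y: "0 \<le> ?y" "4 * ?y \<le> ?\<kappa>"
      using \<kappa> a mult_nonneg_nonneg[of a "exp (-4)"] by (auto simp: algebra_simps intro: add_increasing2)
    have "?y * (1 + - (4 * \<alpha>)) \<le> ?y * exp (- (4 * \<alpha>))"
      by (intro mult_left_mono exp_ge_add_one_self y)
    moreover have "4 * ?y * \<alpha> \<le> ?\<kappa> * \<alpha>" using y \<alpha> by (intro mult_right_mono) auto
    ultimately have "1 - (\<alpha> + a) + (\<alpha> + a) * exp (-4) \<le> ?y * exp (- (4 * \<alpha>))"
      by (simp add: algebra_simps)
    then have "tilted_mgf 1 \<alpha> (\<alpha> + a) \<le> exp (4 * \<alpha>) * (?y * exp (- (4 * \<alpha>)))"
      unfolding tilted_mgf_def by simp
    also have "\<dots> = ?y" by (simp add: exp_minus)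
    also have "\<dots> \<le> 1 - a * (9816/10000)" using \<kappa> a by (simp add: mult_left_mono)
    also have "\<dots> \<le> tilting_line a" using a by (simp add: tilting_line_def)
    finally have "tilted_mgf 1 \<alpha> (\<alpha> + a) \<le> tilting_line a" .
    then show ?thesis using 4 by simp
  qed
qed


text \<open>For \<open>e < 2/5\<close> the line is the tangent to the Gaussian at \<open>e\<close>.
  Its value at 1 is \<open>exp (- 2 * e\<^sup>2) * (1 - 2 * e)\<^sup>2\<close>, which drops below
  the attainable minimum \<open>exp (- 4)\<close> as \<open>e\<close> approaches \<open>1/2\<close>;
  larger \<open>e\<close> therefore share \<open>tilting_line\<close>.\<close>

theorem exists_tilting:
  fixes e :: real
  assumes "0 < e" "e < 1"
  obtains l k :: real and C :: "real \<Rightarrow> real" where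
    "0 \<le> k" "l - k * e \<le> exp (- 2 * e\<^sup>2)" "C \<in> borel_measurable borel"
    "\<And>a. 0 \<le> C a" "\<And>a. C a \<le> 1"
    "\<And>\<alpha> a. \<lbrakk>0 \<le> \<alpha>; 0 \<le> a; \<alpha> + a \<le> 1\<rbrakk> \<Longrightarrow> tilted_mgf (C a) \<alpha> (\<alpha> + a) \<le> l - k * a"
proof -
  note numsimps = lessThan_nat_numeral fact_numeral power_divide
  let ?T = "\<lambda>e. exp (- 2 * e\<^sup>2) * (1 + 4 * e\<^sup>2)" and ?K = "\<lambda>e. exp (- 2 * e\<^sup>2) * 4 * e :: real"
  \<comment> \<open>Hoeffding's choice is used up to \<open>b\<close>. The test
    \<open>0 \<le> a\<close> keeps the values in \<open>[0, 1]\<close> for negative arguments as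
    well.\<close>
  let ?C = "\<lambda>b a. if 0 \<le> a \<and> a < b then a
      else if a < 81/200 then 153/400 else if a < 3/5 then 99/200 else (1::real)"
  have meas: "?C b \<in> borel_measurable borel" for b by measurable
  show thesis
  proof (cases "e < 2/5")
    case True
    \<comment> \<open>The tangent at \<open>2/5\<close> lies above \<open>tilting_line\<close> here,
      and at a fixed \<open>a \<ge> 1/2\<close> the height of the tangent at \<open>e\<close>
      decreases in \<open>e\<close> on the range considered.\<close>
    have bound: "tilting_line a \<le> ?T e - ?K e * a" if "1/2 \<le> a" "a \<le> 1" for a
    proof -
      let ?E = "exp (- 2 * (2/5)\<^sup>2) :: real"
      have E: "7261/10000 \<le> ?E"
        by (rule order_trans[OF _ exp_ge_even_Taylor[of 8]]) (simp_all add: numsimps)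
      have "tilting_line a \<le> 7261/10000 * (1 - 4 * (2/5) * (a - 2/5))"
        using that unfolding tilting_line_def by (simp add: field_simps)
      also have "\<dots> \<le> ?E * (1 - 4 * (2/5) * (a - 2/5))"
        using that E by (intro mult_right_mono) auto
      also have "\<dots> \<le> exp (- 2 * e\<^sup>2) * (1 - 4 * e * (a - e))"
      proof (rule DERIV_nonpos_imp_nonincreasing[where f = "\<lambda>e. exp (- 2 * e\<^sup>2) * (1 - 4 * e * (a - e))"])
        fix x :: real assume x: "e \<le> x" "x \<le> 2/5"
        have "x\<^sup>2 \<le> (1/2)\<^sup>2" using x assms by (intro power_mono) auto
        then have "0 \<le> (a - x) * (1 - 4 * x\<^sup>2)"
          using x that by (intro mult_nonneg_nonneg) (auto simp: power2_eq_square)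
        then have "0 \<le> exp (- 2 * x\<^sup>2) * ((a - x) * (1 - 4 * x\<^sup>2))"
          by (rule mult_nonneg_nonneg[OF exp_ge_zero])
        moreover have "((\<lambda>e. exp (- 2 * e\<^sup>2) * (1 - 4 * e * (a - e))) has_real_derivative
            - 4 * (exp (- 2 * x\<^sup>2) * ((a - x) * (1 - 4 * x\<^sup>2)))) (at x)"
          by (auto intro!: derivative_eq_intros simp: power2_eq_square algebra_simps)
        ultimately show "\<exists>y. ((\<lambda>e. exp (- 2 * e\<^sup>2) * (1 - 4 * e * (a - e))) has_real_derivative y)
            (at x) \<and> y \<le> 0"
          by (intro exI[of _ "- 4 * (exp (- 2 * x\<^sup>2) * ((a - x) * (1 - 4 * x\<^sup>2)))"]) linarith
      qed (use True in auto)
      finally show ?thesis by (simp add: algebra_simps power2_eq_square)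
    qed
    show thesis
    proof (rule that[of "?K e" "?T e" "?C (1/2)"])
      fix \<alpha> a :: real assume \<alpha>: "0 \<le> \<alpha>" "0 \<le> a" "\<alpha> + a \<le> 1"
      show "tilted_mgf (?C (1/2) a) \<alpha> (\<alpha> + a) \<le> ?T e - ?K e * a"
      proof (cases "a < 1/2")
        case a: True
        then show ?thesis
          using tilted_mgf_le_Hoeffding[OF \<alpha>] gaussian_le_tangent[of e a] assms True \<alpha> by simp
      next
        case False
        then show ?thesis
          using tilted_mgf_le_tilting_line[of \<alpha> a] bound[of a] \<alpha> by simp
      qed
    qed (use assms meas in \<open>auto simp: algebra_simps power2_eq_square\<close>)
  next
    case False
    have bound: "?T (63/200) - ?K (63/200) * a \<le> tilting_line a" if "0 \<le> a" "a \<le> 63/200" for a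
    proof -
      have "?T (63/200) - ?K (63/200) * a \<le> tilting_line 0 - 4 * (597/1000) * (49025/100000) * a"
      proof (rule line_le_line_between[OF _ _ that])
        have "exp (- 2 * (63/200)\<^sup>2) \<le> (8202/10000 :: real)" (is "?E \<le> _")
          by (rule exp_le_inverse_even_Taylor[of 6]; simp add: numsimps)
        then show "?T (63/200) - ?K (63/200) * (63/200) \<le> tilting_line 0 - 4 * (597/1000) * (49025/100000) * (63/200)"
          "?T (63/200) - ?K (63/200) * 0 \<le> tilting_line 0 - 4 * (597/1000) * (49025/100000) * 0"
          by (simp_all add: tilting_line_def power2_eq_square)
      qed
      then show ?thesis by (simp add: tilting_line_alt[of a])
    qed
    show thesis
    proof (rule that[of "4 * (597/1000) * (49025/100000)" "tilting_line 0" "?C (63/200)"])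
      show "tilting_line 0 - 4 * (597/1000) * (49025/100000) * e \<le> exp (- 2 * e\<^sup>2)"
        using tilting_line_le_gaussian[of e] False by (simp add: tilting_line_alt[of e])
    next
      fix \<alpha> a :: real assume \<alpha>: "0 \<le> \<alpha>" "0 \<le> a" "\<alpha> + a \<le> 1"
      have "tilted_mgf (?C (63/200) a) \<alpha> (\<alpha> + a) \<le> tilting_line a"
      proof (cases "a < 63/200")
        case True
        then show ?thesis
          using tilted_mgf_le_Hoeffding[OF \<alpha>] gaussian_le_tangent[of "63/200" a] bound[of a] \<alpha> by simp
      next
        case False
        then show ?thesis
          using tilted_mgf_le_tilting_line[of \<alpha> a] \<alpha> by simp
      qed
      then show "tilted_mgf (?C (63/200) a) \<alpha> (\<alpha> + a)
          \<le> tilting_line 0 - 4 * (597/1000) * (49025/100000) * a" by (simp add: tilting_line_alt[of a])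
    qed (use meas in auto)
  qed
qed

section \<open>A covering argument for empirical measures in the tau topology\<close>

lemma space_XY [simp]: "space (XY :: ('x::topological_space \<times> 'y) measure) = UNIV"
  by (simp add: XY_def space_pair_measure)

lemma M1D:
  assumes "\<nu> \<in> M1"
  shows "prob_space \<nu>" "sets \<nu> = sets XY" "space \<nu> = UNIV"
  using assms sets_eq_imp_space_eq[of \<nu> XY] by (auto simp: M1_def)

lemma measurable_M1_iff:
  assumes "\<nu> \<in> M1"
  shows "f \<in> measurable \<nu> N \<longleftrightarrow> f \<in> measurable XY N"
  using measurable_cong_sets[OF M1D(2)[OF assms] refl, of N] by simp

lemma integrable_M1:
  fixes f :: "'x::topological_space \<times> 'y \<Rightarrow> real"
  assumes "\<nu> \<in> M1" "f \<in> borel_measurable XY" "bounded (range f)"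
  shows "integrable \<nu> f"
proof -
  interpret prob_space \<nu> by (rule M1D[OF assms(1)])
  obtain B where "\<And>z. norm (f z) \<le> B" using assms(3) by (auto simp: bounded_iff)
  then show ?thesis
    using assms by (intro integrable_const_bound[where B = B]) (auto simp: measurable_M1_iff)
qed

text \<open>Markov's inequality is applied to \<open>exp\<close> of the sum, whose expectation
  factorises under the product measure.\<close>

lemma measure_sum_ge_le_exponential:
  fixes g :: "'a \<Rightarrow> real" and \<theta> :: real
  assumes P: "prob_space P" and g [measurable]: "g \<in> borel_measurable P"
    and e: "integrable P (\<lambda>z. exp (g z))"
  shows "measure (PiM {..<m} (\<lambda>_. P)) {w \<in> space (PiM {..<m} (\<lambda>_. P)). m * \<theta> \<le> (\<Sum>i<m. g (w i))}
    \<le> (exp (- \<theta>) * (\<integral>z. exp (g z) \<partial>P)) ^ m"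
proof -
  interpret P: prob_space P by fact
  interpret PP: product_prob_space "\<lambda>_. P" "{..<m}" by unfold_locales
  interpret Q: prob_space "PiM {..<m} (\<lambda>_. P)" by (intro prob_space_PiM P)
  let ?Q = "PiM {..<m} (\<lambda>_. P)"
  have int: "integrable ?Q (\<lambda>w. \<Prod>i<m. exp (g (w i)))"
    using PP.product_integrable_prod[of "{..<m}" "\<lambda>_ z. exp (g z)"] e by simp
  have "exp (m * \<theta>) * measure ?Q {w \<in> space ?Q. m * \<theta> \<le> (\<Sum>i<m. g (w i))}
      = exp (m * \<theta>) * measure ?Q {w \<in> space ?Q. exp (m * \<theta>) \<le> (\<Prod>i<m. exp (g (w i)))}"
    by (simp add: exp_sum[symmetric])
  also have "\<dots> \<le> (\<integral>w. (\<Prod>i<m. exp (g (w i))) \<partial>?Q)"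
  proof -
    have "measure ?Q {w \<in> space ?Q. exp (m * \<theta>) \<le> (\<Prod>i<m. exp (g (w i)))}
        \<le> (\<integral>w. (\<Prod>i<m. exp (g (w i))) \<partial>?Q) / exp (m * \<theta>)"
      using int by (intro integral_Markov_inequality_measure[where A = "space ?Q"])
        (auto intro!: prod_nonneg)
    then show ?thesis by (simp add: field_simps)
  qed
  also have "\<dots> = (\<integral>z. exp (g z) \<partial>P) ^ m"
    using PP.product_integral_prod[of "{..<m}" "\<lambda>_ z. exp (g z)"] e by simp
  finally show ?thesis
    by (simp add: power_mult_distrib exp_minus power_inverse field_simps flip: exp_of_nat_mult)
qed

lemma empirical_M1:
  assumes "0 < m"
  shows "empirical m w \<in> (M1 :: ('x::topological_space \<times> 'y) measure set)"
proof -
  have "prob_space (uniform_count_measure {..<m})"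
    using assms by (intro prob_space_uniform_count_measure) auto
  moreover have "w \<in> measurable (uniform_count_measure {..<m}) (XY :: ('x \<times> 'y) measure)"
    by (rule measurableI) (auto simp: sets_uniform_count_measure space_uniform_count_measure)
  ultimately show ?thesis
    by (auto simp: M1_def empirical_def intro!: prob_space.prob_space_distr)
qed

lemma integral_empirical:
  fixes g :: "'x::topological_space \<times> 'y \<Rightarrow> real"
  assumes "g \<in> borel_measurable XY"
  shows "(\<integral>z. g z \<partial>empirical m w) = (\<Sum>i<m. g (w i)) / m"
proof -
  have "w \<in> measurable (uniform_count_measure {..<m}) (XY :: ('x \<times> 'y) measure)"
    by (rule measurableI) (auto simp: sets_uniform_count_measure space_uniform_count_measure)
  then show ?thesis
    unfolding empirical_def using assms
    by (simp add: integral_distr integral_uniform_count_measure)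
qed

section \<open>From tau-open sets to cylinders of set functions\<close>

lemma continuous_on_coordinate_sum:
  fixes c :: "'i \<Rightarrow> real" and A :: "'i \<Rightarrow> 'a"
  shows "continuous_on UNIV (\<lambda>\<psi>::'a \<Rightarrow> real. \<Sum>j\<in>J. c j * \<psi> (A j))"
  by (intro continuous_intros continuous_on_product_coordinates)

text \<open>Rounding \<open>f\<close> down to multiples of \<eta> leaves finitely many levels by
  boundedness. Level sets and coefficients do not depend on \<mu>, so one finite set of coordinates
  of \<open>measure \<mu>\<close> serves all \<mu> at once.\<close>

lemma integral_approx_finite_sum:
  fixes f :: "'x::topological_space \<times> 'y \<Rightarrow> real" and \<eta> :: real
  assumes f [measurable]: "f \<in> borel_measurable XY" and bnd: "bounded (range f)" and \<eta>: "0 < \<eta>"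
  obtains J :: "int set" and c :: "int \<Rightarrow> real" and A where "finite J" "\<And>j. A j \<in> sets XY"
    "\<And>\<mu>. \<mu> \<in> M1 \<Longrightarrow> \<bar>(\<integral>z. f z \<partial>\<mu>) - (\<Sum>j\<in>J. c j * measure \<mu> (A j))\<bar> \<le> \<eta>"
proof -
  obtain B where B: "\<And>z. \<bar>f z\<bar> \<le> B" using bnd by (auto simp: bounded_iff)
  define J where "J = {\<lfloor>- B / \<eta>\<rfloor>..\<lfloor>B / \<eta>\<rfloor>}"
  define A where "A j = {z. \<lfloor>f z / \<eta>\<rfloor> = j}" for j
  have A: "A j \<in> sets XY" for j
  proof -
    have "{z \<in> space XY. \<lfloor>f z / \<eta>\<rfloor> = j} \<in> sets XY" by measurable
    then show ?thesis by (simp add: A_def)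
  qed
  have J: "\<lfloor>f z / \<eta>\<rfloor> \<in> J" for z
    using B[of z] \<eta> unfolding J_def
    by (auto intro!: floor_mono divide_right_mono simp: abs_le_iff simp del: divide_minus_left)
  have s: "(\<Sum>j\<in>J. \<eta> * of_int j * indicator (A j) z) = \<eta> * \<lfloor>f z / \<eta>\<rfloor>" for z
  proof -
    have "(\<Sum>j\<in>J. \<eta> * of_int j * indicator (A j) z)
        = (\<Sum>j\<in>J. if j = \<lfloor>f z / \<eta>\<rfloor> then \<eta> * of_int j else 0)"
      by (intro sum.cong) (auto simp: A_def)
    then show ?thesis using J[of z] by (simp add: J_def)
  qed
  have close: "\<bar>f z - \<eta> * \<lfloor>f z / \<eta>\<rfloor>\<bar> \<le> \<eta>" for z
  proof -
    have "\<eta> * \<lfloor>f z / \<eta>\<rfloor> \<le> \<eta> * (f z / \<eta>)" "\<eta> * (f z / \<eta>) \<le> \<eta> * (\<lfloor>f z / \<eta>\<rfloor> + 1)"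
      using \<eta> by (intro mult_left_mono; linarith)+
    then show ?thesis using \<eta> by (simp add: algebra_simps)
  qed
  show thesis
  proof (rule that[of J A "\<lambda>j. \<eta> * of_int j"])
    fix \<mu> :: "('x \<times> 'y) measure" assume \<mu>: "\<mu> \<in> M1"
    interpret prob_space \<mu> by (rule M1D[OF \<mu>])
    have Am: "A j \<in> sets \<mu>" for j using A M1D(2)[OF \<mu>] by simp
    have ii: "integrable \<mu> (indicat_real (A j))" for j
      by (rule integrable_real_indicator) (auto simp: Am less_top[symmetric])
    have i1: "integrable \<mu> (\<lambda>z. \<Sum>j\<in>J. \<eta> * of_int j * indicator (A j) z)"
      using ii by auto
    have "(\<Sum>j\<in>J. \<eta> * of_int j * measure \<mu> (A j)) = (\<integral>z. (\<Sum>j\<in>J. \<eta> * of_int j * indicator (A j) z) \<partial>\<mu>)"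
      using ii Am by (subst Bochner_Integration.integral_sum) (auto simp: M1D(3)[OF \<mu>])
    then have "\<bar>(\<integral>z. f z \<partial>\<mu>) - (\<Sum>j\<in>J. \<eta> * of_int j * measure \<mu> (A j))\<bar>
        = \<bar>\<integral>z. f z - (\<Sum>j\<in>J. \<eta> * of_int j * indicator (A j) z) \<partial>\<mu>\<bar>"
      using i1 integrable_M1[OF \<mu> f bnd] by simp
    also have "\<dots> \<le> (\<integral>z. \<bar>f z - (\<Sum>j\<in>J. \<eta> * of_int j * indicator (A j) z)\<bar> \<partial>\<mu>)"
      using integral_norm_bound by simp
    also have "\<dots> \<le> (\<integral>z. \<eta> \<partial>\<mu>)"
      using i1 integrable_M1[OF \<mu> f bnd] close by (intro integral_mono) (auto simp: s)
    finally show "\<bar>(\<integral>z. f z \<partial>\<mu>) - (\<Sum>j\<in>J. \<eta> * of_int j * measure \<mu> (A j))\<bar> \<le> \<eta>"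
      by (simp add: prob_space)
  qed (use A in \<open>auto simp: J_def\<close>)
qed

text \<open>Agreement of \<phi> with \<open>measure \<nu>\<close> is required only on measurable
  sets, since a point of the cube of set functions is arbitrary elsewhere.\<close>

lemma tau_open_imp_cylinder:
  fixes \<nu> :: "('x::topological_space \<times> 'y) measure"
  assumes "openin tau_top U" "\<nu> \<in> U" "\<nu> \<in> M1" "\<And>A. A \<in> sets XY \<Longrightarrow> \<phi> A = measure \<nu> A"
  shows "\<exists>V. open V \<and> \<phi> \<in> V \<and> (\<forall>\<mu>\<in>M1. measure \<mu> \<in> V \<longrightarrow> \<mu> \<in> U)"
proof -
  have "generate_topology_on tau_subbasis U"
    using assms(1) unfolding tau_top_def openin_topology_generated_by_iff .
  then show ?thesis using assms(2)
  proof (induction rule: generate_topology_on.induct)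
    case Empty
    then show ?case by simp
  next
    case (Int a b)
    then obtain V W where "open V" "\<phi> \<in> V" "\<forall>\<mu>\<in>M1. measure \<mu> \<in> V \<longrightarrow> \<mu> \<in> a"
      "open W" "\<phi> \<in> W" "\<forall>\<mu>\<in>M1. measure \<mu> \<in> W \<longrightarrow> \<mu> \<in> b" by auto
    then show ?case by (intro exI[of _ "V \<inter> W"]) auto
  next
    case (UN K)
    then show ?case by (meson UnionE UnionI)
  next
    case (Basis s)
    from Basis(1) have "\<exists>(f :: 'x \<times> 'y \<Rightarrow> real) r c. s = {\<nu> \<in> M1. \<bar>(\<integral>z. f z \<partial>\<nu>) - r\<bar> < c} \<and>
        f \<in> borel_measurable XY \<and> bounded (range f) \<and> 0 < c"
      by (simp only: tau_subbasis_def mem_Collect_eq)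
    then obtain f :: "'x \<times> 'y \<Rightarrow> real" and r c
      where s: "s = {\<nu> \<in> M1. \<bar>(\<integral>z. f z \<partial>\<nu>) - r\<bar> < c}"
        and f: "f \<in> borel_measurable XY" "bounded (range f)"
      by (elim exE conjE)
    \<comment> \<open>One third of the slack pays for the approximation under \<nu>, one for that
      under \<mu>, and one keeps the inequality of \<open>?V\<close> strict at \<phi>.\<close>
    define \<eta> where "\<eta> = (c - \<bar>(\<integral>z. f z \<partial>\<nu>) - r\<bar>) / 3"
    have \<eta>: "0 < \<eta>" using Basis s by (simp add: \<eta>_def)
    obtain J :: "int set" and d A where J: "finite J" "\<And>j. A j \<in> sets XY"
      "\<And>\<mu>. \<mu> \<in> M1 \<Longrightarrow> \<bar>(\<integral>z. f z \<partial>\<mu>) - (\<Sum>j\<in>J. d j * measure \<mu> (A j))\<bar> \<le> \<eta>"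
      using integral_approx_finite_sum[OF f \<eta>] by metis
    let ?V = "{\<psi>. \<bar>(\<Sum>j\<in>J. d j * \<psi> (A j)) - r\<bar> < c - \<eta>}"
    have "open ?V"
      by (intro open_Collect_less continuous_intros continuous_on_coordinate_sum)
    moreover have "\<phi> \<in> ?V"
    proof -
      have "(\<Sum>j\<in>J. d j * \<phi> (A j)) = (\<Sum>j\<in>J. d j * measure \<nu> (A j))"
        using J(2) assms(4) by simp
      moreover have "\<bar>(\<integral>z. f z \<partial>\<nu>) - r\<bar> = c - 3 * \<eta>" by (simp add: \<eta>_def field_simps)
      ultimately show ?thesis using J(3)[OF assms(3)] \<eta> by auto
    qed
    moreover have "\<mu> \<in> s" if "\<mu> \<in> M1" "measure \<mu> \<in> ?V" for \<mu>
      using J(3)[OF that(1)] that unfolding s by auto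
    ultimately show ?case by blast
  qed
qed


text \<open>The covering step of Sanov's theorem: in the compact cube of all set functions
  with values in \<open>[0, 1]\<close>, a point that is not a countably additive probability either has a
  neighbourhood without measures, or gives mass bounded below to sets \<open>A n\<close> decreasing to \<open>{}\<close>, and
  then \<open>t * indicator (A n)\<close> serves as an exponential test function with arbitrarily good rate.\<close>
lemma exponential_cover:
  fixes P :: "('x::topological_space \<times> 'y) measure" and R :: real
  assumes P: "P \<in> M1" and S: "S \<subseteq> M1"
    and cover: "\<And>\<nu>. \<nu> \<in> M1 \<Longrightarrow> (\<exists>U. openin tau_top U \<and> \<nu> \<in> U \<and> U \<inter> S = {}) \<or>
      (\<exists>g \<theta>. g \<in> borel_measurable XY \<and> bounded (range g) \<and> \<theta> < (\<integral>z. g z \<partial>\<nu>) \<and>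
        exp (- \<theta>) * (\<integral>z. exp (g z) \<partial>P) \<le> exp (- R))"
  obtains D :: "(('x \<times> 'y) set \<Rightarrow> real) set" and g \<theta> where "finite D"
    "\<And>d. g d \<in> borel_measurable XY" "\<And>d. bounded (range (g d))"
    "\<And>d. exp (- \<theta> d) * (\<integral>z. exp (g d z) \<partial>P) \<le> exp (- R)"
    "\<And>\<nu>. \<nu> \<in> S \<Longrightarrow> \<exists>d\<in>D. \<theta> d \<le> (\<integral>z. g d z \<partial>\<nu>)"
proof -
  interpret P: prob_space P by (rule M1D[OF P])
  let ?test = "\<lambda>g \<theta>. g \<in> borel_measurable XY \<and> bounded (range g) \<and>
      exp (- \<theta>) * (\<integral>z. exp (g z) \<partial>P) \<le> exp (- R)"
  define good where "good V g \<theta> \<longleftrightarrow> open V \<and> ?test g \<theta> \<and>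
      (\<forall>\<nu>\<in>S. measure \<nu> \<in> V \<longrightarrow> \<theta> \<le> (\<integral>z. g z \<partial>\<nu>))"
    for V :: "(('x \<times> 'y) set \<Rightarrow> real) set" and g :: "'x \<times> 'y \<Rightarrow> real" and \<theta>
  \<comment> \<open>Where no member of \<open>S\<close> occurs, the zero function with threshold
    \<open>R\<close> passes vacuously.\<close>
  have triv: "good V (\<lambda>_. 0) R" if "open V" "\<forall>\<nu>\<in>S. measure \<nu> \<notin> V" for V
    using that unfolding good_def by (auto simp: P.prob_space bounded_iff)
  let ?Q = "PiE UNIV (\<lambda>_. {0..1}) :: (('x \<times> 'y) set \<Rightarrow> real) set"
  have "\<exists>V g \<theta>. \<phi> \<in> V \<and> good V g \<theta>" if \<phi>: "\<phi> \<in> ?Q" for \<phi>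
  proof -
    have found: ?thesis if "good V g \<theta>" "\<phi> \<in> V" for V g \<theta>
      using that by blast
    have \<phi>01: "0 \<le> \<phi> A" "\<phi> A \<le> 1" for A using \<phi> by (auto simp: PiE_iff)
    \<comment> \<open>Either \<phi> violates normalisation, additivity or continuity at the empty
      set, or it restricts to a probability measure.\<close>
    consider "\<phi> UNIV \<noteq> 1"
      | A B where "A \<in> sets XY" "B \<in> sets XY" "A \<inter> B = {}" "\<phi> (A \<union> B) \<noteq> \<phi> A + \<phi> B"
      | A where "range A \<subseteq> sets XY" "decseq A" "(\<Inter>i. A i) = {}" "\<not> (\<lambda>i. \<phi> (A i)) \<longlonglongrightarrow> 0"
      | "\<phi> UNIV = 1" "\<And>A B. A \<in> sets XY \<Longrightarrow> B \<in> sets XY \<Longrightarrow> A \<inter> B = {} \<Longrightarrow> \<phi> (A \<union> B) = \<phi> A + \<phi> B"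
        "\<And>A. range A \<subseteq> sets XY \<Longrightarrow> decseq A \<Longrightarrow> (\<Inter>i. A i) = {} \<Longrightarrow> (\<lambda>i. \<phi> (A i)) \<longlonglongrightarrow> 0"
      by blast
    then show ?thesis
    proof cases
      case 1
      have "good {\<psi>. \<psi> UNIV \<noteq> 1} (\<lambda>_. 0) R"
      proof (rule triv)
        show "\<forall>\<nu>\<in>S. measure \<nu> \<notin> {\<psi>. \<psi> UNIV \<noteq> 1}"
          using S M1D(1,3) prob_space.prob_space by fastforce
      qed (intro open_Collect_neq continuous_intros continuous_on_product_coordinates)
      then show ?thesis by (rule found) (use 1 in simp)
    next
      case 2
      have "good {\<psi>. \<psi> (A \<union> B) \<noteq> \<psi> A + \<psi> B} (\<lambda>_. 0) R"
      proof (rule triv)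
        show "\<forall>\<nu>\<in>S. measure \<nu> \<notin> {\<psi>. \<psi> (A \<union> B) \<noteq> \<psi> A + \<psi> B}"
        proof
          fix \<nu> assume "\<nu> \<in> S"
          then have "\<nu> \<in> M1" using S by auto
          interpret prob_space \<nu> by (rule M1D) fact
          show "measure \<nu> \<notin> {\<psi>. \<psi> (A \<union> B) \<noteq> \<psi> A + \<psi> B}"
            using 2 finite_measure_Union[of A B] by (simp add: M1D(2)[OF \<open>\<nu> \<in> M1\<close>])
        qed
      qed (intro open_Collect_neq continuous_intros continuous_on_product_coordinates)
      then show ?thesis by (rule found) (use 2 in simp)
    next
      case 3
      then obtain \<delta> where \<delta>: "0 < \<delta>" "\<And>n. \<exists>k\<ge>n. \<delta> \<le> \<phi> (A k)"
        using \<phi>01 unfolding LIMSEQ_iff by (auto simp: not_less)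
      \<comment> \<open>The exponent becomes \<open>\<bar>R\<bar> + 1\<close>; the extra 1 absorbs
        the moment generating function, at most \<open>2 \<le> exp 1\<close> once \<open>A k\<close>
        has small mass under \<open>P\<close>. Halving \<delta> gives an open condition that holds
        at \<phi>.\<close>
      define t where "t = (\<bar>R\<bar> + 1) / (\<delta> / 2)"
      have t: "0 < t" "t * (\<delta> / 2) = \<bar>R\<bar> + 1" using \<delta> by (auto simp: t_def)
      have As: "A n \<in> sets P" for n using 3 M1D(2)[OF P] by auto
      have "(\<lambda>n. P.prob (A n)) \<longlonglongrightarrow> P.prob (\<Inter>n. A n)"
        using 3 As by (intro P.finite_Lim_measure_decseq) auto
      then have "(\<lambda>n. P.prob (A n) * (exp t - 1)) \<longlonglongrightarrow> 0"
        using 3 by (auto intro: tendsto_mult_left_zero)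
      then have "eventually (\<lambda>n. P.prob (A n) * (exp t - 1) < 1) sequentially"
        by (rule order_tendstoD) simp
      then obtain n where n: "\<And>k. n \<le> k \<Longrightarrow> P.prob (A k) * (exp t - 1) < 1"
        by (auto simp: eventually_sequentially)
      obtain k where k: "n \<le> k" "\<delta> \<le> \<phi> (A k)" using \<delta>(2) by blast
      let ?g = "\<lambda>z. t * indicator (A k) z :: real"
      have ii: "integrable P (indicat_real (A k))"
        by (rule integrable_real_indicator) (auto simp: As less_top[symmetric])
      have "(\<lambda>z. exp (?g z)) = (\<lambda>z. 1 + (exp t - 1) * indicator (A k) z)"
        by (auto simp: indicator_def)
      then have "(\<integral>z. exp (?g z) \<partial>P) = 1 + (exp t - 1) * P.prob (A k)"
        using ii As P.prob_space by (simp add: M1D(3)[OF P])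
      also have "\<dots> \<le> 2" using n[OF k(1)] by (simp add: mult.commute)
      also have "\<dots> \<le> exp 1" using exp_ge_add_one_self[of 1] by simp
      finally have "exp (- (t * (\<delta> / 2))) * (\<integral>z. exp (?g z) \<partial>P) \<le> exp (- (\<bar>R\<bar> + 1)) * exp 1"
        unfolding t(2) by (rule mult_left_mono) simp
      also have "\<dots> \<le> exp (- R)" by (simp flip: exp_add)
      finally have "exp (- (t * (\<delta> / 2))) * (\<integral>z. exp (?g z) \<partial>P) \<le> exp (- R)" .
      moreover have "t * (\<delta> / 2) \<le> (\<integral>z. ?g z \<partial>\<nu>)" if "\<nu> \<in> S" "\<delta> / 2 < measure \<nu> (A k)" for \<nu>
      proof -
        have \<nu>: "\<nu> \<in> M1" using S that by auto
        interpret prob_space \<nu> by (rule M1D[OF \<nu>])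
        have "t * (\<delta> / 2) \<le> t * measure \<nu> (A k)" using that t by (intro mult_left_mono) auto
        then show ?thesis by (simp add: M1D(3)[OF \<nu>])
      qed
      moreover have "open {\<psi>. \<delta> / 2 < \<psi> (A k)}"
        by (intro open_Collect_less continuous_intros continuous_on_product_coordinates)
      moreover have "?g \<in> borel_measurable XY"
        using 3 by (intro borel_measurable_times borel_measurable_indicator) auto
      moreover have "bounded (range ?g)"
        by (auto simp: bounded_iff indicator_def intro!: exI[of _ t] less_imp_le[OF t(1)])
      ultimately have "good {\<psi>. \<delta> / 2 < \<psi> (A k)} ?g (t * (\<delta> / 2))"
        unfolding good_def by simp
      moreover have "\<phi> \<in> {\<psi>. \<delta> / 2 < \<psi> (A k)}" using k \<delta> by simp
      ultimately show ?thesis by (rule found)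
    next
      case 4
      define \<nu> where "\<nu> = measure_of UNIV (sets (XY :: ('x \<times> 'y) measure)) (\<lambda>A. ennreal (\<phi> A))"
      interpret XY: sigma_algebra UNIV "sets (XY :: ('x \<times> 'y) measure)"
        using sets.sigma_algebra_axioms[of XY] by simp
      have pos: "positive (sets XY) (\<lambda>A. ennreal (\<phi> A))"
        using 4(2)[of "{}" "{}"] by (auto simp: positive_def)
      moreover have "countably_additive (sets XY) (\<lambda>A. ennreal (\<phi> A))"
      proof (rule XY.empty_continuous_imp_countably_additive[OF pos])
        show "additive (sets XY) (\<lambda>A. ennreal (\<phi> A))"
          using 4(2) \<phi>01 by (auto simp: additive_def ennreal_plus[symmetric] simp del: ennreal_plus)
      qed (use 4(3) in \<open>auto intro!: tendsto_ennrealI[of _ 0, simplified]\<close>)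
      ultimately have em: "emeasure \<nu> A = ennreal (\<phi> A)" if "A \<in> sets XY" for A
        using that unfolding \<nu>_def
        by (intro emeasure_measure_of_sigma) (auto simp: XY.sigma_algebra_axioms)
      have sets: "sets \<nu> = sets XY" unfolding \<nu>_def by simp
      have "space \<nu> = UNIV" using sets_eq_imp_space_eq[OF sets] by simp
      then have \<nu>: "\<nu> \<in> M1"
        unfolding M1_def using em[of UNIV] 4(1) sets by (auto intro!: prob_spaceI)
      have eq: "\<phi> A = measure \<nu> A" if "A \<in> sets XY" for A
        using em[OF that] \<phi>01 by (simp add: measure_def)
      from cover[OF \<nu>] show ?thesis
      proof (elim disjE exE conjE)
        fix U assume U: "openin tau_top U" "\<nu> \<in> U" "U \<inter> S = {}"
        obtain V where "open V" "\<phi> \<in> V" "\<forall>\<mu>\<in>M1. measure \<mu> \<in> V \<longrightarrow> \<mu> \<in> U"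
          using tau_open_imp_cylinder[OF U(1,2) \<nu> eq] by blast
        then have "good V (\<lambda>_. 0) R" using U S by (intro triv) auto
        then show ?thesis using \<open>\<phi> \<in> V\<close> by (rule found)
      next
        fix g \<theta> assume g: "g \<in> borel_measurable XY" "bounded (range g)" "\<theta> < (\<integral>z. g z \<partial>\<nu>)"
          "exp (- \<theta>) * (\<integral>z. exp (g z) \<partial>P) \<le> exp (- R)"
        let ?r = "\<integral>z. g z \<partial>\<nu>"
        \<comment> \<open>Membership in this tau-neighbourhood forces the integral of
          \<open>g\<close> above \<theta>.\<close>
        let ?U = "{\<mu> \<in> M1. \<bar>(\<integral>z. g z \<partial>\<mu>) - ?r\<bar> < ?r - \<theta>}"
        have "?U \<in> tau_subbasis"
          unfolding tau_subbasis_def mem_Collect_eq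
          by (rule exI[of _ g], rule exI[of _ ?r], rule exI[of _ "?r - \<theta>"]) (use g in simp)
        then have "openin tau_top ?U"
          unfolding tau_top_def by (rule topology_generated_by_Basis)
        moreover have "\<nu> \<in> ?U" using \<nu> g by simp
        ultimately obtain V where V: "open V" "\<phi> \<in> V" "\<forall>\<mu>\<in>M1. measure \<mu> \<in> V \<longrightarrow> \<mu> \<in> ?U"
          using tau_open_imp_cylinder[OF _ _ \<nu> eq, of ?U] by blast
        have "\<theta> \<le> (\<integral>z. g z \<partial>\<mu>)" if "\<mu> \<in> S" "measure \<mu> \<in> V" for \<mu>
        proof -
          have "\<mu> \<in> ?U" using V(3) that S by blast
          then show ?thesis by auto
        qed
        then have "good V g \<theta>" using V(1) g unfolding good_def by auto
        then show ?thesis using V(2) by (rule found)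
      qed
    qed
  qed
  then obtain V g \<theta> where V: "\<And>\<phi>. \<phi> \<in> ?Q \<Longrightarrow> \<phi> \<in> V \<phi> \<and> good (V \<phi>) (g \<phi>) (\<theta> \<phi>)"
    by metis
  \<comment> \<open>Tychonoff's theorem for the cube.\<close>
  have "compact ?Q"
    using compactin_PiE[of "\<lambda>_. euclideanreal" UNIV "\<lambda>_. {0..1}"]
    by (simp add: euclidean_product_topology)
  then obtain D where D: "D \<subseteq> ?Q" "finite D" "?Q \<subseteq> (\<Union>\<phi>\<in>D. V \<phi>)"
    by (rule compactE_image[of ?Q ?Q V]) (use V in \<open>auto simp: good_def\<close>)
  \<comment> \<open>The test must hold for every index, so indices outside the cube receive a
    trivially passing pair.\<close>
  let ?g = "\<lambda>\<phi>. if \<phi> \<in> ?Q then g \<phi> else (\<lambda>_. 0)" and ?\<theta> = "\<lambda>\<phi>. if \<phi> \<in> ?Q then \<theta> \<phi> else R"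
  have test: "?test (?g \<phi>) (?\<theta> \<phi>)" for \<phi>
    using V[of \<phi>] unfolding good_def by (auto simp: P.prob_space bounded_iff)
  show thesis
  proof (rule that[of D ?g ?\<theta>])
    fix \<nu> assume "\<nu> \<in> S"
    then have "\<nu> \<in> M1" using S by auto
    interpret prob_space \<nu> by (rule M1D) fact
    have "measure \<nu> \<in> ?Q" by (auto simp: PiE_iff)
    then obtain \<phi> where "\<phi> \<in> D" "measure \<nu> \<in> V \<phi>" using D by auto
    moreover have "\<phi> \<in> ?Q" using \<open>\<phi> \<in> D\<close> D by auto
    ultimately show "\<exists>\<phi>\<in>D. ?\<theta> \<phi> \<le> (\<integral>z. ?g \<phi> z \<partial>\<nu>)"
      using V[of \<phi>] \<open>\<nu> \<in> S\<close> unfolding good_def by (intro bexI[of _ \<phi>]) auto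
  qed (use D test in blast)+
qed

section \<open>Disintegration and the test function\<close>

lemma LsimpD:
  assumes "f \<in> Lsimp"
  shows "(\<lambda>x. f x y) \<in> borel_measurable borel" "0 \<le> f x y" "(\<Sum>y\<in>UNIV. f x y) = 1" "f x y \<le> 1"
proof -
  show 1: "(\<lambda>x. f x y) \<in> borel_measurable borel" "0 \<le> f x y" "(\<Sum>y\<in>UNIV. f x y) = 1" for y
    using assms by (auto simp: Lsimp_def in_simplex_def)
  show "f x y \<le> 1"
    using member_le_sum[of y UNIV "f x"] 1 by simp
qed

lemma measurable_XY_fst [measurable]: "fst \<in> measurable XY borel"
  unfolding XY_def by measurable

lemma borel_measurable_XY:
  fixes f :: "'x::topological_space \<Rightarrow> 'y::finite \<Rightarrow> real"
  assumes "\<And>y. (\<lambda>x. f x y) \<in> borel_measurable borel"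
  shows "(\<lambda>z. f (fst z) (snd z)) \<in> borel_measurable XY"
proof -
  have "(\<lambda>z. f (fst z) (snd z)) = (\<lambda>z. \<Sum>y\<in>UNIV. f (fst z) y * indicator {y} (snd z))"
    by (simp add: indicator_def sum.If_cases)
  moreover have "(\<lambda>z. indicat_real {y} (snd z)) \<in> borel_measurable (XY :: ('x \<times> 'y) measure)" for y
    unfolding XY_def by (rule measurable_compose[OF measurable_snd]) simp
  moreover have "(\<lambda>z. f (fst z) y) \<in> borel_measurable XY" for y
    by (rule measurable_compose[OF measurable_XY_fst assms])
  ultimately show ?thesis
    by (simp only:) (intro borel_measurable_sum borel_measurable_times)
qed

lemma marg_prob_space:
  assumes "\<nu> \<in> M1" shows "prob_space (marg \<nu>)" "space (marg \<nu>) = UNIV" "sets (marg \<nu>) = sets borel"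
  using assms unfolding marg_def
  by (auto intro!: prob_space.prob_space_distr M1D simp: measurable_M1_iff)

lemma integral_marg:
  fixes h :: "'x::topological_space \<Rightarrow> real"
  assumes "\<nu> \<in> M1" "h \<in> borel_measurable borel"
  shows "(\<integral>x. h x \<partial>marg \<nu>) = (\<integral>z. h (fst z) \<partial>\<nu>)"
  using assms unfolding marg_def by (intro integral_distr) (auto simp: measurable_M1_iff)

lemma integrable_marg:
  fixes h :: "'x::topological_space \<Rightarrow> real"
  assumes "\<nu> \<in> M1" "h \<in> borel_measurable borel" "\<And>x. \<bar>h x\<bar> \<le> B"
  shows "integrable (marg \<nu>) h"
proof -
  interpret prob_space "marg \<nu>" by (rule marg_prob_space) fact
  show ?thesis
    using assms by (intro integrable_const_bound[where B = B])
      (auto simp: measurable_cong_sets[OF marg_prob_space(3)[OF assms(1)] refl])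
qed

text \<open>\<open>is_cond\<close> speaks only of rectangles \<open>A \<times> {y}\<close>. Hence
  \<nu> restricted to the label \<open>y\<close> and projected has density \<open>q x y\<close> with
  respect to the marginal; summing over the finitely many labels gives the formula.\<close>

lemma integral_disintegration:
  fixes u :: "'x::topological_space \<Rightarrow> 'y::finite \<Rightarrow> real"
  assumes \<nu>: "\<nu> \<in> M1" and q: "is_cond \<nu> q"
    and u: "\<And>y. (\<lambda>x. u x y) \<in> borel_measurable borel" and bnd: "\<And>x y. \<bar>u x y\<bar> \<le> B"
  shows "(\<integral>z. u (fst z) (snd z) \<partial>\<nu>) = (\<integral>x. (\<Sum>y\<in>UNIV. u x y * q x y) \<partial>marg \<nu>)"
proof -
  interpret prob_space \<nu> by (rule M1D[OF \<nu>])
  have qL: "q \<in> Lsimp" using q by (simp add: is_cond_def)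
  note qD = LsimpD[OF qL]
  have mm: "f \<in> borel_measurable (marg \<nu>) \<longleftrightarrow> f \<in> borel_measurable borel" for f :: "'x \<Rightarrow> 'b::topological_space"
    by (rule measurable_cong_sets[OF marg_prob_space(3)[OF \<nu>] refl, THEN arg_cong[where f = "\<lambda>S. f \<in> S"]])
  have fst: "fst \<in> measurable \<nu> borel" by (simp add: measurable_M1_iff[OF \<nu>])
  have ind: "(\<lambda>z. indicat_real {y} (snd z)) \<in> borel_measurable \<nu>" for y
    unfolding measurable_M1_iff[OF \<nu>] by (rule borel_measurable_XY[of "\<lambda>x. indicator {y}"]) simp
  have ufst: "(\<lambda>z. u (fst z) y) \<in> borel_measurable \<nu>" for y
    using measurable_compose[OF fst u] .
  have slice: "(\<integral>z. u (fst z) y * indicator {y} (snd z) \<partial>\<nu>) = (\<integral>x. u x y * q x y \<partial>marg \<nu>)" for y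
  proof -
    let ?D = "density \<nu> (\<lambda>z. ennreal (indicator {y} (snd z)))"
    have fstD: "fst \<in> measurable ?D borel" using fst by simp
    have "distr ?D borel fst = density (marg \<nu>) (\<lambda>x. ennreal (q x y))"
    proof (rule measure_eqI)
      fix A assume "A \<in> sets (distr ?D borel fst)"
      then have A: "A \<in> sets borel" by simp
      have Ay: "A \<times> {y} \<in> sets \<nu>"
        unfolding M1D(2)[OF \<nu>] XY_def using A by (intro pair_measureI) auto
      have fA: "fst -` A \<in> sets \<nu>"
        using measurable_sets[OF fst A] by (simp add: M1D(3)[OF \<nu>])
      have "emeasure (distr ?D borel fst) A = emeasure ?D (fst -` A)"
        using A by (subst emeasure_distr[OF fstD]) (auto simp: M1D(3)[OF \<nu>])
      also have "\<dots> = (\<integral>\<^sup>+z. ennreal (indicator {y} (snd z)) * indicator (fst -` A) z \<partial>\<nu>)"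
        using ind fA by (intro emeasure_density) auto
      also have "\<dots> = (\<integral>\<^sup>+z. indicator (A \<times> {y}) z \<partial>\<nu>)"
        by (intro nn_integral_cong) (auto simp: indicator_def)
      also have "\<dots> = ennreal (measure \<nu> (A \<times> {y}))"
        using Ay by (simp add: emeasure_eq_measure)
      also have "measure \<nu> (A \<times> {y}) = (\<integral>x. indicator A x * q x y \<partial>marg \<nu>)"
        using q A by (simp add: is_cond_def)
      also have "ennreal \<dots> = (\<integral>\<^sup>+x. ennreal (indicator A x * q x y) \<partial>marg \<nu>)"
        using A qD by (intro nn_integral_eq_integral[symmetric] integrable_marg[OF \<nu>, where B = 1])
          (auto simp: indicator_def)
      also have "\<dots> = (\<integral>\<^sup>+x. ennreal (q x y) * indicator A x \<partial>marg \<nu>)"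
        by (intro nn_integral_cong) (auto simp: indicator_def)
      also have "\<dots> = emeasure (density (marg \<nu>) (\<lambda>x. ennreal (q x y))) A"
        using A qD(1) by (intro emeasure_density[symmetric]) (auto simp: marg_prob_space[OF \<nu>] mm)
      finally show "emeasure (distr ?D borel fst) A = emeasure (density (marg \<nu>) (\<lambda>x. ennreal (q x y))) A" .
    qed (simp add: marg_prob_space[OF \<nu>])
    then have "(\<integral>x. u x y \<partial>distr ?D borel fst) = (\<integral>x. u x y \<partial>density (marg \<nu>) (\<lambda>x. ennreal (q x y)))"
      by simp
    moreover have "(\<integral>x. u x y \<partial>distr ?D borel fst) = (\<integral>z. u (fst z) y \<partial>?D)"
      by (rule integral_distr[OF fstD u])
    moreover have "\<dots> = (\<integral>z. indicator {y} (snd z) * u (fst z) y \<partial>\<nu>)"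
      using ind ufst by (subst integral_density) auto
    moreover have "(\<integral>x. u x y \<partial>density (marg \<nu>) (\<lambda>x. ennreal (q x y))) = (\<integral>x. q x y * u x y \<partial>marg \<nu>)"
      using qD u by (subst integral_density) (auto simp: mm)
    ultimately show ?thesis by (simp add: mult.commute)
  qed
  have "(\<integral>z. u (fst z) (snd z) \<partial>\<nu>) = (\<integral>z. (\<Sum>y\<in>UNIV. u (fst z) y * indicator {y} (snd z)) \<partial>\<nu>)"
    by (intro Bochner_Integration.integral_cong refl) (simp add: indicator_def sum.If_cases)
  also have "\<dots> = (\<Sum>y\<in>UNIV. \<integral>z. u (fst z) y * indicator {y} (snd z) \<partial>\<nu>)"
  proof (rule Bochner_Integration.integral_sum)
    fix y
    have "\<bar>u (fst z) y * indicator {y} (snd z)\<bar> \<le> B" for z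
      using bnd[of "fst z" y] by (auto simp: indicator_def)
    then show "integrable \<nu> (\<lambda>z. u (fst z) y * indicator {y} (snd z))"
      using ufst ind by (intro integrable_const_bound[where B = B]) auto
  qed
  also have "\<dots> = (\<Sum>y\<in>UNIV. \<integral>x. u x y * q x y \<partial>marg \<nu>)" by (simp add: slice)
  also have "\<dots> = (\<integral>x. (\<Sum>y\<in>UNIV. u x y * q x y) \<partial>marg \<nu>)"
  proof (rule Bochner_Integration.integral_sum[symmetric])
    fix y
    have "\<bar>u x y * q x y\<bar> \<le> B" for x
      using bnd[of x y] qD(2,4)[of x y] mult_left_le[of "q x y" "\<bar>u x y\<bar>"] by (simp add: abs_mult)
    then show "integrable (marg \<nu>) (\<lambda>x. u x y * q x y)"
      using u qD(1) by (intro integrable_marg[OF \<nu>, where B = B]) auto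
  qed
  finally show ?thesis .
qed

section \<open>Total variation on the simplex\<close>

lemma tv_bounds:
  assumes "f \<in> Lsimp" "g \<in> Lsimp"
  shows "0 \<le> tv (f x) (g x)" "tv (f x) (g x) \<le> 1" "(\<lambda>x. tv (f x) (g x)) \<in> borel_measurable borel"
proof -
  show "0 \<le> tv (f x) (g x)" by (simp add: tv_def sum_nonneg)
  have "(\<Sum>y\<in>UNIV. \<bar>f x y - g x y\<bar>) \<le> (\<Sum>y\<in>UNIV. f x y + g x y)"
    using LsimpD(2)[OF assms(1)] LsimpD(2)[OF assms(2)] by (intro sum_mono) (auto simp: abs_le_iff add_increasing)
  then show "tv (f x) (g x) \<le> 1"
    using LsimpD(3)[OF assms(1)] LsimpD(3)[OF assms(2)] by (simp add: tv_def sum.distrib)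
  show "(\<lambda>x. tv (f x) (g x)) \<in> borel_measurable borel"
    unfolding tv_def using LsimpD(1)[OF assms(1)] LsimpD(1)[OF assms(2)]
    by (intro borel_measurable_times borel_measurable_sum borel_measurable_abs borel_measurable_diff) auto
qed

lemma tv_triangle: "tv a b \<le> tv a c + tv b c"
proof -
  have "(\<Sum>y\<in>UNIV. \<bar>a y - b y\<bar>) \<le> (\<Sum>y\<in>UNIV. \<bar>a y - c y\<bar> + \<bar>b y - c y\<bar>)"
    using abs_triangle_ineq4[of "a y - c y" "b y - c y" for y] by (intro sum_mono) simp
  then show ?thesis by (simp add: tv_def sum.distrib)
qed

lemma integrable_tv:
  assumes "P \<in> M1" "f \<in> Lsimp" "g \<in> Lsimp"
  shows "integrable (marg P) (\<lambda>x. tv (f x) (g x))"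
  using tv_bounds[OF assms(2,3)] by (intro integrable_marg[OF assms(1), where B = 1]) auto

text \<open>This Lipschitz bound lets continuity of \<open>F\<close> separate a measure of small
  error from the set of large errors by a tau-open set.\<close>

lemma delta_bar_le_dL1:
  assumes "P \<in> M1" "p \<in> Lsimp" "f \<in> Lsimp" "g \<in> Lsimp"
  shows "delta_bar (marg P) p f \<le> delta_bar (marg P) p g + dL1 (marg P) f g"
proof -
  note int = integrable_tv[OF assms(1)]
  have "delta_bar (marg P) p f \<le> (\<integral>x. tv (p x) (g x) + tv (f x) (g x) \<partial>marg P)"
    unfolding delta_bar_def
    by (intro integral_mono Bochner_Integration.integrable_add int assms tv_triangle)
  also have "\<dots> = delta_bar (marg P) p g + dL1 (marg P) f g"
    unfolding delta_bar_def dL1_def by (intro Bochner_Integration.integral_add int assms)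
  finally show ?thesis .
qed

text \<open>An absolute value is twice the positive part minus the number itself, and the
  differences sum to zero.\<close>

lemma tv_eq_sum_positive_part:
  fixes a b :: "'y::finite \<Rightarrow> real"
  assumes "(\<Sum>y\<in>UNIV. a y) = (\<Sum>y\<in>UNIV. b y)"
  shows "tv a b = (\<Sum>y\<in>UNIV. (a y - b y) * of_bool (b y < a y))"
proof -
  have "(\<Sum>y\<in>UNIV. \<bar>a y - b y\<bar>) = (\<Sum>y\<in>UNIV. 2 * ((a y - b y) * of_bool (b y < a y)) - (a y - b y))"
    by (intro sum.cong) auto
  also have "\<dots> = 2 * (\<Sum>y\<in>UNIV. (a y - b y) * of_bool (b y < a y))"
    using assms by (simp only: sum_subtractf sum_distrib_left[symmetric] diff_self diff_zero)
  finally show ?thesis by (simp add: tv_def)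
qed

lemma sum_diff_le_tv:
  fixes a b :: "'y::finite \<Rightarrow> real"
  assumes "(\<Sum>y\<in>UNIV. a y) = (\<Sum>y\<in>UNIV. b y)"
  shows "(\<Sum>y\<in>UNIV. (a y - b y) * of_bool (Q y)) \<le> tv a b"
  unfolding tv_eq_sum_positive_part[OF assms] by (intro sum_mono) auto

lemma sum_exp_tilt:
  fixes p :: "'y::finite \<Rightarrow> real"
  assumes "(\<Sum>y\<in>UNIV. p y) = 1"
  shows "(\<Sum>y\<in>UNIV. exp (- 4 * c * (of_bool (Q y) - \<alpha>)) * p y)
    = tilted_mgf c \<alpha> (\<Sum>y\<in>UNIV. p y * of_bool (Q y))"
proof -
  have "(\<Sum>y\<in>UNIV. exp (- 4 * c * (of_bool (Q y) - \<alpha>)) * p y)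
      = (\<Sum>y\<in>UNIV. exp (4 * c * \<alpha>) * (p y - p y * of_bool (Q y) + p y * of_bool (Q y) * exp (- (4 * c))))"
    by (intro sum.cong) (auto simp: algebra_simps simp flip: exp_add)
  also have "\<dots> = tilted_mgf c \<alpha> (\<Sum>y\<in>UNIV. p y * of_bool (Q y))"
    using assms by (simp add: tilted_mgf_def sum.distrib sum_subtractf flip: sum_distrib_left sum_distrib_right)
  finally show ?thesis .
qed

text \<open>Integrating out the label against \<open>q\<close> bounds the mean under \<nu> through
  \<open>tv (q x) (f x)\<close>; against \<open>pc\<close> it yields \<open>tilted_mgf\<close>, to
  which \<open>exists_tilting\<close> applies pointwise.\<close>

lemma exists_test_function:
  fixes P \<nu> :: "('x::topological_space \<times> 'y::finite) measure"
  assumes P: "P \<in> M1" and pc: "is_cond P pc" and e: "0 < e" "e < 1"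
    and \<nu>: "\<nu> \<in> M1" and q: "is_cond \<nu> q" and f: "f \<in> Lsimp"
    and fit: "(\<integral>z. tv (q (fst z)) (f (fst z)) \<partial>\<nu>) \<le> \<zeta>"
    and err: "e \<le> delta_bar (marg P) pc f"
  obtains g where "g \<in> borel_measurable XY" "bounded (range g)"
    "- 4 * \<zeta> \<le> (\<integral>z. g z \<partial>\<nu>)" "(\<integral>z. exp (g z) \<partial>P) \<le> exp (- 2 * e\<^sup>2)"
proof -
  obtain l k :: real and C :: "real \<Rightarrow> real" where k: "0 \<le> k" "l - k * e \<le> exp (- 2 * e\<^sup>2)"
    and C: "C \<in> borel_measurable borel" "\<And>a. 0 \<le> C a" "\<And>a. C a \<le> 1"
    and tilt: "\<And>\<alpha> a. \<lbrakk>0 \<le> \<alpha>; 0 \<le> a; \<alpha> + a \<le> 1\<rbrakk> \<Longrightarrow> tilted_mgf (C a) \<alpha> (\<alpha> + a) \<le> l - k * a"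
    using exists_tilting[OF e] by metis
  have pL: "pc \<in> Lsimp" and qL: "q \<in> Lsimp" using pc q by (auto simp: is_cond_def)
  note pD = LsimpD[OF pL] and qD = LsimpD[OF qL] and fD = LsimpD[OF f]
  define a where "a x = tv (pc x) (f x)" for x
  define \<alpha> where "\<alpha> x = (\<Sum>y\<in>UNIV. f x y * of_bool (f x y < pc x y))" for x
  define u where "u x y = - 4 * C (a x) * (of_bool (f x y < pc x y) - \<alpha> x)" for x y
  have a: "0 \<le> a x" "a \<in> borel_measurable borel" for x
    using tv_bounds[OF pL f] by (auto simp: a_def[abs_def])
  interpret PX: prob_space "marg P" by (rule marg_prob_space[OF P])
  have aint: "integrable (marg P) a"
    using a tv_bounds[OF pL f] by (intro integrable_marg[OF P, where B = 1]) (auto simp: a_def)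
  \<comment> \<open>On the set where \<open>pc\<close> exceeds \<open>f\<close>, the two masses
    differ by exactly the total variation.\<close>
  have p\<alpha>: "(\<Sum>y\<in>UNIV. pc x y * of_bool (f x y < pc x y)) = \<alpha> x + a x" for x
    using tv_eq_sum_positive_part[of "pc x" "f x"] pD(3) fD(3)
    by (simp add: a_def \<alpha>_def left_diff_distrib sum_subtractf)
  have \<alpha>0: "0 \<le> \<alpha> x" for x using fD(2) by (simp add: \<alpha>_def sum_nonneg)
  have \<alpha>1: "\<alpha> x + a x \<le> 1" for x
    unfolding p\<alpha>[symmetric] pD(3)[of x, symmetric] using pD(2) by (intro sum_mono) auto
  have Im: "(\<lambda>x. of_bool (f x y < pc x y) :: real) \<in> borel_measurable borel" for y
  proof -
    have "{x \<in> space borel. f x y < pc x y} \<in> sets borel"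
      by (rule borel_measurable_less[OF fD(1) pD(1)])
    then have "indicat_real {x. f x y < pc x y} \<in> borel_measurable borel" by simp
    then show ?thesis by (simp add: indicator_def[abs_def] of_bool_def)
  qed
  have \<alpha>m: "\<alpha> \<in> borel_measurable borel"
    unfolding \<alpha>_def[abs_def] using fD(1) Im by (intro borel_measurable_sum borel_measurable_times) auto
  have um: "(\<lambda>x. u x y) \<in> borel_measurable borel" for y
    unfolding u_def using \<alpha>m Im measurable_compose[OF a(2) C(1)]
    by (intro borel_measurable_times borel_measurable_diff) auto
  have ub: "\<bar>u x y\<bar> \<le> 4" for x y
  proof -
    have "\<bar>of_bool (f x y < pc x y) - \<alpha> x\<bar> \<le> 1" using \<alpha>0[of x] \<alpha>1[of x] a(1)[of x] by auto
    then have "C (a x) * \<bar>of_bool (f x y < pc x y) - \<alpha> x\<bar> \<le> 1"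
      using C(2,3) by (intro mult_le_one) auto
    then show ?thesis using C(2)[of "a x"] by (simp add: u_def abs_mult)
  qed
  show thesis
  proof (rule that[of "\<lambda>z. u (fst z) (snd z)"])
    show "(\<lambda>z. u (fst z) (snd z)) \<in> borel_measurable XY" by (rule borel_measurable_XY[OF um])
    show "bounded (range (\<lambda>z. u (fst z) (snd z)))" using ub by (auto simp: bounded_iff)
    have "(\<integral>z. exp (u (fst z) (snd z)) \<partial>P) = (\<integral>x. (\<Sum>y\<in>UNIV. exp (u x y) * pc x y) \<partial>marg P)"
      using um ub by (intro integral_disintegration[OF P pc, where B = "exp 4"]) (auto simp: abs_le_iff)
    also have "\<dots> \<le> (\<integral>x. l - k * a x \<partial>marg P)"
    proof (rule integral_mono)
      have "(\<Sum>y\<in>UNIV. exp (u x y) * pc x y) \<le> (\<Sum>y\<in>UNIV. exp 4 * pc x y)" for x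
        using ub pD(2) by (intro sum_mono mult_right_mono) (auto simp: abs_le_iff)
      then have "\<bar>\<Sum>y\<in>UNIV. exp (u x y) * pc x y\<bar> \<le> exp 4" for x
        using pD(2,3) by (simp add: sum_nonneg flip: sum_distrib_left)
      then show "integrable (marg P) (\<lambda>x. \<Sum>y\<in>UNIV. exp (u x y) * pc x y)"
        using um pD(1) by (intro integrable_marg[OF P, where B = "exp 4"]) auto
      show "integrable (marg P) (\<lambda>x. l - k * a x)" using PX.integrable_const aint by simp
      show "(\<Sum>y\<in>UNIV. exp (u x y) * pc x y) \<le> l - k * a x" for x
        using tilt[OF \<alpha>0 a(1) \<alpha>1] sum_exp_tilt[OF pD(3)[of x], of "C (a x)" "\<lambda>y. f x y < pc x y" "\<alpha> x"]
        unfolding u_def p\<alpha> by simp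
    qed
    also have "\<dots> = l - k * delta_bar (marg P) pc f"
    proof -
      have "delta_bar (marg P) pc f = (\<integral>x. a x \<partial>marg P)" by (simp add: delta_bar_def a_def)
      then show ?thesis using aint PX.prob_space by simp
    qed
    also have "\<dots> \<le> l - k * e" using err k by (simp add: mult_left_mono)
    finally show "(\<integral>z. exp (u (fst z) (snd z)) \<partial>P) \<le> exp (- 2 * e\<^sup>2)" using k by linarith
    have "- 4 * \<zeta> \<le> - 4 * (\<integral>x. tv (q x) (f x) \<partial>marg \<nu>)"
      using fit integral_marg[OF \<nu> tv_bounds(3)[OF qL f]] by simp
    also have "\<dots> = (\<integral>x. - 4 * tv (q x) (f x) \<partial>marg \<nu>)" by simp
    also have "\<dots> \<le> (\<integral>x. (\<Sum>y\<in>UNIV. u x y * q x y) \<partial>marg \<nu>)"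
    proof (rule integral_mono)
      have "\<bar>u x y * q x y\<bar> \<le> 4 * q x y" for x y
        using ub[of x y] qD(2)[of x y] by (simp add: abs_mult mult_right_mono)
      then have "\<bar>\<Sum>y\<in>UNIV. u x y * q x y\<bar> \<le> (\<Sum>y\<in>UNIV. 4 * q x y)" for x
        by (intro order_trans[OF sum_abs] sum_mono)
      then have "\<bar>\<Sum>y\<in>UNIV. u x y * q x y\<bar> \<le> 4" for x
        using qD(3) by (simp flip: sum_distrib_left)
      then show "integrable (marg \<nu>) (\<lambda>x. \<Sum>y\<in>UNIV. u x y * q x y)"
        using um qD(1) by (intro integrable_marg[OF \<nu>, where B = 4]) auto
      show "integrable (marg \<nu>) (\<lambda>x. - 4 * tv (q x) (f x))"
        using tv_bounds[OF qL f] by (intro integrable_marg[OF \<nu>, where B = 4]) auto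
      fix x
      let ?s = "\<Sum>y\<in>UNIV. (q x y - f x y) * of_bool (f x y < pc x y)"
      have "?s \<le> tv (q x) (f x)" using qD(3) fD(3) by (intro sum_diff_le_tv) simp
      \<comment> \<open>The bound \<open>C \<le> 1\<close> is used for nonnegative
        \<open>?s\<close>, and \<open>0 \<le> C\<close> for negative \<open>?s\<close>.\<close>
      moreover have "C (a x) * ?s \<le> max 0 ?s"
      proof (cases "0 \<le> ?s")
        case True
        then show ?thesis using C mult_right_mono[OF C(3) True, of "a x"] by simp
      next
        case False
        then show ?thesis using C(2)[of "a x"] by (simp add: mult_nonneg_nonpos max_def)
      qed
      moreover have "0 \<le> tv (q x) (f x)" by (rule tv_bounds[OF qL f])
      ultimately have "C (a x) * ?s \<le> tv (q x) (f x)" by linarith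
      moreover have "(\<Sum>y\<in>UNIV. u x y * q x y) = - 4 * (C (a x) * ?s)"
      proof -
        have "(\<Sum>y\<in>UNIV. u x y * q x y)
            = (\<Sum>y\<in>UNIV. - 4 * C (a x) * (q x y * of_bool (f x y < pc x y) - \<alpha> x * q x y))"
          by (intro sum.cong) (simp_all add: u_def algebra_simps)
        also have "\<dots> = - 4 * C (a x) * ((\<Sum>y\<in>UNIV. q x y * of_bool (f x y < pc x y)) - \<alpha> x)"
          using qD(3)[of x] by (simp only: sum_distrib_left[symmetric] sum_subtractf mult_1_right)
        also have "\<dots> = - 4 * (C (a x) * ?s)"
          by (simp only: \<alpha>_def left_diff_distrib sum_subtractf mult.assoc)
        finally show ?thesis .
      qed
      ultimately show "- 4 * tv (q x) (f x) \<le> (\<Sum>y\<in>UNIV. u x y * q x y)" by simp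
    qed
    also have "\<dots> = (\<integral>z. u (fst z) (snd z) \<partial>\<nu>)"
      by (rule integral_disintegration[OF \<nu> q um ub, symmetric])
    finally show "- 4 * \<zeta> \<le> (\<integral>z. u (fst z) (snd z) \<partial>\<nu>)" .
  qed
qed


section \<open>The upper bound\<close>

lemma limsup_elog_le:
  fixes p :: "nat \<Rightarrow> real"
  assumes "\<And>m. 0 < m \<Longrightarrow> p m \<le> K * exp (- R) ^ m"
  shows "limsup (\<lambda>m. ereal (1 / real m) * elog (p m)) \<le> ereal (- R)"
proof -
  \<comment> \<open>The maximum with 1 keeps the logarithm meaningful if \<open>K\<close> is zero,
    as for an empty cover.\<close>
  define K' where "K' = max K 1"
  have "ereal (1 / real m) * elog (p m) \<le> ereal (ln K' / m - R)" if m: "0 < m" for m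
  proof (cases "p m \<le> 0")
    case True
    then show ?thesis using m by (simp add: elog_def)
  next
    case False
    have "p m \<le> K' * exp (- R) ^ m"
      using assms[OF m] by (rule order_trans) (simp add: K'_def)
    then have "ln (p m) \<le> ln (K' * exp (- R) ^ m)" using False by (intro ln_mono) auto
    also have "\<dots> = ln K' + m * (- R)"
      by (subst ln_mult) (auto simp: K'_def ln_realpow)
    finally have "1 / m * ln (p m) \<le> 1 / m * (ln K' + m * (- R))"
      by (intro mult_left_mono) auto
    also have "\<dots> = ln K' / m - R" using m by (simp add: field_simps)
    finally show ?thesis using False by (simp add: elog_def)
  qed
  then have "limsup (\<lambda>m. ereal (1 / real m) * elog (p m)) \<le> limsup (\<lambda>m. ereal (ln K' / real m - R))"
    by (intro Limsup_mono) (auto simp: eventually_sequentially intro!: exI[of _ 1])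
  also have "(\<lambda>m. ln K' / real m - R) \<longlonglongrightarrow> 0 - R"
    by (intro tendsto_diff tendsto_const lim_const_over_n)
  then have "limsup (\<lambda>m. ereal (ln K' / real m - R)) = ereal (- R)"
    by (intro lim_imp_Limsup) (auto simp: trivial_limit_sequentially)
  finally show ?thesis .
qed

lemma outer_prob_le:
  assumes "A \<in> sets M" "S \<subseteq> A"
  shows "outer_prob M S \<le> measure M A"
  unfolding outer_prob_def using assms
  by (intro cInf_lower) (auto intro: bdd_belowI[of _ 0])

text \<open>A union bound: each test turns membership in \<open>S\<close> into a measurable event
  about a sum over the sample, and finitely many such events cover.\<close>

lemma outer_prob_empirical_le:
  fixes P :: "('x::topological_space \<times> 'y) measure"
  assumes P: "P \<in> M1" and D: "finite D" and m: "0 < m"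
    and g: "\<And>d. g d \<in> borel_measurable XY" "\<And>d. bounded (range (g d))"
    and rate: "\<And>d. exp (- \<theta> d) * (\<integral>z. exp (g d z) \<partial>P) \<le> exp (- R)"
    and cover: "\<And>\<nu>. \<nu> \<in> S \<Longrightarrow> \<exists>d\<in>D. \<theta> d \<le> (\<integral>z. g d z \<partial>\<nu>)"
  shows "outer_prob (PiM {..<m} (\<lambda>_. P)) {w \<in> space (PiM {..<m} (\<lambda>_. P)). empirical m w \<in> S}
    \<le> card D * exp (- R) ^ m"
proof -
  let ?Q = "PiM {..<m} (\<lambda>_. P)"
  interpret prob_space P by (rule M1D[OF P])
  interpret Q: prob_space ?Q by (intro prob_space_PiM M1D[OF P])
  let ?A = "\<lambda>d. {w \<in> space ?Q. m * \<theta> d \<le> (\<Sum>i<m. g d (w i))}"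
  have gm [measurable]: "g d \<in> borel_measurable P" for d using g(1) by (simp add: measurable_M1_iff[OF P])
  have A: "?A d \<in> sets ?Q" for d by measurable
  have le: "measure ?Q (?A d) \<le> exp (- R) ^ m" for d
  proof -
    obtain B where B: "\<And>z. \<bar>g d z\<bar> \<le> B" using g(2)[of d] by (auto simp: bounded_iff)
    have "integrable P (\<lambda>z. exp (g d z))"
      using B by (intro integrable_const_bound[where B = "exp B"]) (auto simp: abs_le_iff)
    then have "measure ?Q (?A d) \<le> (exp (- \<theta> d) * (\<integral>z. exp (g d z) \<partial>P)) ^ m"
      by (intro measure_sum_ge_le_exponential gm M1D[OF P])
    also have "\<dots> \<le> exp (- R) ^ m"
      using rate by (intro power_mono mult_nonneg_nonneg integral_nonneg) auto
    finally show ?thesis .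
  qed
  have "outer_prob ?Q {w \<in> space ?Q. empirical m w \<in> S} \<le> measure ?Q (\<Union>d\<in>D. ?A d)"
  proof (rule outer_prob_le)
    show "{w \<in> space ?Q. empirical m w \<in> S} \<subseteq> (\<Union>d\<in>D. ?A d)"
    proof
      fix w assume w: "w \<in> {w \<in> space ?Q. empirical m w \<in> S}"
      then obtain d where d: "d \<in> D" "\<theta> d \<le> (\<integral>z. g d z \<partial>empirical m w)" using cover by blast
      then have "\<theta> d \<le> (\<Sum>i<m. g d (w i)) / m" by (simp add: integral_empirical[OF g(1)])
      then show "w \<in> (\<Union>d\<in>D. ?A d)" using m d w by (auto simp: field_simps)
    qed
  qed (use A D in auto)
  also have "\<dots> \<le> (\<Sum>d\<in>D. measure ?Q (?A d))"
    using A D by (intro Q.finite_measure_subadditive_finite) auto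
  also have "\<dots> \<le> (\<Sum>d\<in>D. exp (- R) ^ m)" by (intro sum_mono le)
  finally show ?thesis by simp
qed

theorem theorem3:
  fixes P :: "('x::polish_space \<times> 'y::finite) measure"
    and pc :: "'x \<Rightarrow> 'y \<Rightarrow> real"
    and F :: "('x \<times> 'y) measure \<Rightarrow> 'x \<Rightarrow> 'y \<Rightarrow> real"
    and \<epsilon> \<zeta> :: real
  assumes P: "P \<in> M1"
    and full_support: "msupport (marg P) = UNIV"
    and pc: "is_cond P pc"
    and eps: "0 < \<epsilon>" "\<epsilon> < 1"
    and zeta: "0 < \<zeta>" "\<zeta> < 1"
    and cont: "tau_continuous (marg P) F"
    and cond_F: "\<forall>\<nu>\<in>M1. \<exists>q. is_cond \<nu> q
        \<and> (\<forall>x\<in>msupport (marg \<nu>). tv (q x) (F \<nu> x) \<le> tv (pc x) (F \<nu> x))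
        \<and> (\<integral>z. tv (q (fst z)) (F \<nu> (fst z)) \<partial>\<nu>) \<le> \<zeta>"
  shows "limsup (\<lambda>m. ereal (1 / real m) *
            elog (outer_prob (PiM {..<m} (\<lambda>_. P))
              {w \<in> space (PiM {..<m} (\<lambda>_. P)). delta_bar (marg P) pc (F (empirical m w)) \<ge> \<epsilon>}))
         \<le> ereal (4 * \<zeta> - 2 * \<epsilon>\<^sup>2)"
proof (rule ereal_le_epsilon2)
  fix \<eta> :: real assume \<eta>: "0 < \<eta>"
  \<comment> \<open>The slack \<eta> makes the threshold \<open>- 4 * \<zeta> - \<eta>\<close>
    strictly smaller than the integral of \<open>g\<close>, as the covering requires.\<close>
  define R where "R = 2 * \<epsilon>\<^sup>2 - 4 * \<zeta> - \<eta>"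
  define S where "S = {\<nu> \<in> M1. \<epsilon> \<le> delta_bar (marg P) pc (F \<nu>)}"
  have pL: "pc \<in> Lsimp" using pc by (simp add: is_cond_def)
  have FL: "F \<nu> \<in> Lsimp" if "\<nu> \<in> M1" for \<nu> using cont that by (simp add: tau_continuous_def)
  have cover: "(\<exists>U. openin tau_top U \<and> \<nu> \<in> U \<and> U \<inter> S = {}) \<or>
      (\<exists>g \<theta>. g \<in> borel_measurable XY \<and> bounded (range g) \<and> \<theta> < (\<integral>z. g z \<partial>\<nu>) \<and>
        exp (- \<theta>) * (\<integral>z. exp (g z) \<partial>P) \<le> exp (- R))" if \<nu>: "\<nu> \<in> M1" for \<nu>
  proof (cases "\<nu> \<in> S")
    case True
    obtain q where "is_cond \<nu> q" "(\<integral>z. tv (q (fst z)) (F \<nu> (fst z)) \<partial>\<nu>) \<le> \<zeta>"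
      using cond_F \<nu> by blast
    then obtain g where g: "g \<in> borel_measurable XY" "bounded (range g)"
      "- 4 * \<zeta> \<le> (\<integral>z. g z \<partial>\<nu>)" "(\<integral>z. exp (g z) \<partial>P) \<le> exp (- 2 * \<epsilon>\<^sup>2)"
      using exists_test_function[OF P pc eps \<nu> _ FL[OF \<nu>]] True by (auto simp: S_def)
    have "exp (- (- 4 * \<zeta> - \<eta>)) * (\<integral>z. exp (g z) \<partial>P)
        \<le> exp (- (- 4 * \<zeta> - \<eta>)) * exp (- 2 * \<epsilon>\<^sup>2)"
      using g by (intro mult_left_mono) auto
    also have "\<dots> = exp (- R)" by (simp add: R_def flip: exp_add)
    finally show ?thesis
      using g \<eta> by (intro disjI2 exI[of _ g] exI[of _ "- 4 * \<zeta> - \<eta>"]) auto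
  next
    case False
    let ?e = "\<epsilon> - delta_bar (marg P) pc (F \<nu>)"
    have "0 < ?e" using False \<nu> by (simp add: S_def)
    then obtain U where U: "openin tau_top U" "\<nu> \<in> U" "\<And>\<mu>. \<mu> \<in> U \<Longrightarrow> dL1 (marg P) (F \<mu>) (F \<nu>) < ?e"
      using cont \<nu> unfolding tau_continuous_def by meson
    have "U \<inter> S = {}"
      using U(3) delta_bar_le_dL1[OF P pL FL FL[OF \<nu>]] by (fastforce simp: S_def)
    with U show ?thesis by blast
  qed
  have "S \<subseteq> M1" by (auto simp: S_def)
  from exponential_cover[OF P this cover]
  obtain D :: "(('x \<times> 'y) set \<Rightarrow> real) set" and g \<theta> where D: "finite D"
    "\<And>d. g d \<in> borel_measurable XY" "\<And>d. bounded (range (g d))"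
    "\<And>d. exp (- \<theta> d) * (\<integral>z. exp (g d z) \<partial>P) \<le> exp (- R)"
    "\<And>\<nu>. \<nu> \<in> S \<Longrightarrow> \<exists>d\<in>D. \<theta> d \<le> (\<integral>z. g d z \<partial>\<nu>)"
    by metis
  \<comment> \<open>For positive \<open>m\<close> the empirical measure lies in \<open>M1\<close>,
    so the event is membership in \<open>S\<close>.\<close>
  have "outer_prob (PiM {..<m} (\<lambda>_. P))
      {w \<in> space (PiM {..<m} (\<lambda>_. P)). delta_bar (marg P) pc (F (empirical m w)) \<ge> \<epsilon>}
      \<le> card D * exp (- R) ^ m" if "0 < m" for m
    using outer_prob_empirical_le[OF P D(1) that D(2-5), of S]
    by (simp add: S_def empirical_M1[OF that])
  from limsup_elog_le[OF this]
  show "limsup (\<lambda>m. ereal (1 / real m) *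
            elog (outer_prob (PiM {..<m} (\<lambda>_. P))
              {w \<in> space (PiM {..<m} (\<lambda>_. P)). delta_bar (marg P) pc (F (empirical m w)) \<ge> \<epsilon>}))
      \<le> ereal (4 * \<zeta> - 2 * \<epsilon>\<^sup>2) + ereal \<eta>"
    by (simp add: R_def algebra_simps)
qed

end
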